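(* The Logic-Based Benders Decomposition algorithm described in the context converges to the optimal solution of the problem $\mathcal{P}$ (described in the context) after finitely many steps.
   Context: **Data.** Finite set of nodes $I=J\cup K\cup L$ (DC hubs $J$, intermediate hubs $K$, satellite hubs $L$). $N$: finite set of orders; each order belongs to one DC hub, $N_j\subset N$ being the orders of hub $j$. $G$: finite set of compartments, partitioned into $G_j$, $j\in J$ (compartments dedicated to hub $j$). All compartments have capacity $q$. Order $n$ has quantity $d_n$, due date $t_n$, weight $w_n$. $S$: finite set of scheduled services; service $s$ has $origin_s\in I\setminus L$, $dest_s\in I$, times $departure_s$, $arrival_s$, variable cost $c^{travel}_s$ per compartment, fixed cost $c^{fixed}_s$, and capacity $Q_s$ (in compartments). $S_L=\{s\in S: dest_s\in L\}$; $\delta^+(i)$ and $\delta^-(i)$ are the services with origin $i$ and destination $i$. $F_s\subset S$ is the set of services $p\neq s$ such that (a) $departure_s\le departure_p<arrival_s$ or $departure_s<arrival_p\le arrival_s$, or (b) $origin_p=dest_s$ and $departure_p<arrival_s$, or (c) $dest_p=origin_s$ and $arrival_p>departure_s$. $c_{nm}$ and $c_{ln}$ are distance costs between delivery points of orders $n,m$, and between satellite hub $l$ and the delivery point of $n$. $M$ is a sufficiently large number. **Intermodal constraints.** Variables $\mathbf{x}=(x_{gs},e_g,E_g,v_s,V_s,y_{ng},h_{ns})$: $x_{gs},y_{ng},e_g,v_s\in\{0,1\}$; $h_{ns}\in\{0,1\}$ for $n\in N$, $s\in S_L$; integers $0\le E_g\le q$, $0\le V_s\le Q_s$; and $y_{ng}=0$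 if $n$ and $g$ belong to different DC hubs. Call (A) the constraints: - $\sum_{g\in G}y_{ng}=1$ for all $n\in N$; - $E_g=\sum_{n\in N}d_ny_{ng}$ for all $g$; $e_g\ge y_{ng}$ for all $g,n$; - $\sum_{s\in\delta^+(j)}x_{gs}=e_g$ for all $j\in J$, $g\in G_j$; - $\sum_{s\in\delta^+(i)}x_{gs}-\sum_{s\in\delta^-(i)}x_{gs}=0$ for all $j\in J$, $g\in G_j$, $i\in I\setminus(L\cup\{j\})$; - $\sum_{l\in L}\sum_{s\in\delta^-(l)}x_{gs}=e_g$ for all $g$; - $x_{gs}+x_{gt}\le1$ for all $g\in G$, $s\in S$, $t\in F_s$; - $V_s=\sum_{g\in G}x_{gs}$ for all $s$; $v_s\ge x_{gs}$ for all $s,g$; - $h_{ns}+1\ge x_{gs}+y_{ng}$ for all $n\in N$, $g\in G$, $s\in S_L$. Let $f(\mathbf{x})=\sum_{s\in S}(c^{travel}_sV_s+c^{fixed}_sv_s)$. **Problem $\mathcal{P}$.** Minimize $f(\mathbf{x})+\sum_{s\in S_L}C^{max}_s+\sum_{n\in N}w_nT_n$ subject to (A) and, with binary $\gamma_{snm}$ ($n\ne m$), $\gamma^+_{sln},\gamma^-_{sln}$, reals $C_{sn},C^{max}_s\ge0$, nonnegative integers $T_n$, for all $l\in L$, $s\in\delta^-(l)$ and $n,m\in N$, $n\neq m$: - $\sum_{n}\gamma^+_{sln}=v_s$; $\sum_n\gamma^-_{sln}=v_s$; - $\sum_m\gamma_{snm}+\gamma^-_{sln}=h_{ns}$; $\sum_m\gamma_{smn}+\gamma^+_{sln}=h_{ns}$;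 - $\gamma^+_{sln}\le h_{ns}$; $\gamma^-_{sln}\le h_{ns}$; $\gamma_{snm}\le h_{ns}$; $\gamma_{snm}\le h_{ms}$; - $C_{sn}+c_{nm}-C_{sm}\le M(1-\gamma_{snm})$; $arrival_s h_{ns}+c_{ln}-C_{sn}\le M(1-\gamma^+_{sln})$; - $T_n\ge\frac{C_{sn}-t_n}{24}$; $C^{max}_s=\sum_{n\ne m}c_{nm}\gamma_{snm}+\sum_nc_{ln}\gamma^+_{sln}$. **Master problem $\mathcal{M}$.** Minimize $z$ subject to (A), $z\ge f(\mathbf{x})$, and the following relaxation constraints with variables $C^\star_s$ (continuous), $T^\star_n$ (nonnegative integers), where $c^{min}_n=\min\{c_{mn},c_{ln}: l\in L, m\in N\setminus\{n\}\}$: $C^\star_s\ge\sum_{n\in N}c^{min}_nh_{ns}$ for $s\in S_L$; $T^\star_n\ge\frac{arrival_s+c_{ln}-t_n}{24}h_{ns}$ for $n\in N$, $l\in L$, $s\in\delta^-(l)$; $z\ge f(\mathbf{x})+\sum_{n\in N}w_nT^\star_n+\sum_{s\in S_L}C^\star_s$. **Subproblems.** Given a solution $\hat{\mathbf{x}}$ of $\mathcal{M}$, for each $s\in S_L$ with $\hat v_s=1$ let $N_s=\{n\in N:\hat h_{ns}=1\}$ and $l=dest_s$. Subproblem $\mathcal{S}^s$ has variables $\gamma_{nm}$ ($n\ne m$), $\gamma^+_{ln},\gamma^-_{ln}$ binary, $C_n,C^{max}\ge0$, $T_n$ nonnegative integers, $n,m\in N_s$, and minimizes $\zeta_s$ subject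 to: - $\sum_{n\in N_s}\gamma^+_{ln}=1$, $\sum_{n\in N_s}\gamma^-_{ln}=1$; - for all $n\in N_s$: $\sum_{m}\gamma_{nm}+\gamma^-_{ln}=1$ and $\sum_m\gamma_{mn}+\gamma^+_{ln}=1$; - $C_n+c_{nm}-C_m\le M(1-\gamma_{nm})$ for $n\ne m$; $arrival_s+c_{ln}-C_n\le M(1-\gamma^+_{ln})$; $T_n\ge\frac{C_n-t_n}{24}$; - $C^{max}=\sum_{n\ne m}c_{nm}\gamma_{nm}+\sum_nc_{ln}\gamma^+_{ln}$; $\zeta_s\ge C^{max}+\sum_{n\in N_s}w_nT_n$. **Algorithm.** 1. Set $r=0$. Solve $\mathcal{M}$; let $\hat{\mathbf{x}}=\hat{\mathbf{x}}_0$ be its optimal solution and $\hat z$ its objective value (the incumbent lower bound on the optimum of $\mathcal{P}$). Let $\epsilon^0(\hat{\mathbf{x}})=1$ (or any positive number). 2. While $f(\hat{\mathbf{x}})+\epsilon^r(\hat{\mathbf{x}})>\hat z$: - set $r=r+1$; solve $\mathcal{S}^s$ for all $s\in S_L$ with $\hat v_s=1$, with optimal values $\zeta^r_s$; let $\epsilon^r(\hat{\mathbf{x}})$ be the sum of these values; - writing $\hat v^{r-1}_s,\hat h^{r-1}_{ns}$ for the components of the current solution $\hat{\mathbf{x}}=\hat{\mathbf{x}}_{r-1}$ and $N^{r-1}_s=\{n\in N:\hat h^{r-1}_{ns}=1\}$, add to $\mathcal{M}$ new nonnegative real variables $z^r_s$ and the optimality cuts $$z^r_s\ge\zeta^r_s-\zeta^r_s\Bigl(|N^{r-1}_s|-\sum_{n\in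 N^{r-1}_s}h_{ns}\Bigr)\quad\forall s\in S_L \text{ with }\hat v^{r-1}_s=1,\qquad z\ge\sum_{s\in S_L:\hat v^{r-1}_s=1}z^r_s+f(\mathbf{x});$$ - solve $\mathcal{M}$; let $\hat{\mathbf{x}}_r$ be its optimal solution and $\hat z$ its optimal value (the new lower bound on $\mathcal{P}$); set $\hat{\mathbf{x}}=\hat{\mathbf{x}}_r$ and let $f(\hat{\mathbf{x}})$ be its cost. 3. Return $\hat z$.
   Formalization: Assumes P feasible, costs and weights nonnegative, triangle inequality for distances, positive distance between distinct orders, positive fixed cost of services into satellites; ε^0 makes the loop start; the loop test uses ε of the current plan, not the previous one. *)

theory Defs
  imports Complex_Main
begin

section \<open>Problem data\<close>

text \<open>Type variables: hubs \<open>'i\<close>, orders \<open>'n\<close>, compartments \<open>'g\<close>, services \<open>'s\<close>.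
  The fields \<open>c_oo\<close> and \<open>c_ho\<close> are the distance costs $c_{nm}$ (order to order) and
  $c_{ln}$ (satellite hub to order). The sets $N_j$ and $G_j$ are the fibres of \<open>order_hub\<close>
  and \<open>comp_hub\<close>.\<close>

record ('i, 'n, 'g, 's) network =
  dc_hubs :: "'i set"
  mid_hubs :: "'i set"
  sat_hubs :: "'i set"
  orders :: "'n set"
  order_hub :: "'n \<Rightarrow> 'i"
  comps :: "'g set"
  comp_hub :: "'g \<Rightarrow> 'i"
  comp_cap :: real
  quantity :: "'n \<Rightarrow> real"
  due :: "'n \<Rightarrow> real"
  weight :: "'n \<Rightarrow> real"
  services :: "'s set"
  orig :: "'s \<Rightarrow> 'i"
  dest :: "'s \<Rightarrow> 'i"
  departure :: "'s \<Rightarrow> real"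
  arrival :: "'s \<Rightarrow> real"
  c_travel :: "'s \<Rightarrow> real"
  c_fixed :: "'s \<Rightarrow> real"
  serv_cap :: "'s \<Rightarrow> real"
  c_oo :: "'n \<Rightarrow> 'n \<Rightarrow> real"
  c_ho :: "'i \<Rightarrow> 'n \<Rightarrow> real"

definition hubs :: "('i, 'n, 'g, 's) network \<Rightarrow> 'i set" where
  "hubs D = dc_hubs D \<union> mid_hubs D \<union> sat_hubs D"

definition sat_services :: "('i, 'n, 'g, 's) network \<Rightarrow> 's set" where
  "sat_services D = {s \<in> services D. dest D s \<in> sat_hubs D}"

definition out_services :: "('i, 'n, 'g, 's) network \<Rightarrow> 'i \<Rightarrow> 's set" where
  "out_services D i = {s \<in> services D. orig D s = i}"

definition in_services :: "('i, 'n, 'g, 's) network \<Rightarrow> 'i \<Rightarrow> 's set" where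
  "in_services D i = {s \<in> services D. dest D s = i}"

text \<open>The set $F_s$ of services incompatible with \<open>s\<close>.\<close>

definition conflicts :: "('i, 'n, 'g, 's) network \<Rightarrow> 's \<Rightarrow> 's set" where
  "conflicts D s = {p \<in> services D. p \<noteq> s \<and>
     ((departure D s \<le> departure D p \<and> departure D p < arrival D s)
      \<or> (departure D s < arrival D p \<and> arrival D p \<le> arrival D s)
      \<or> (orig D p = dest D s \<and> departure D p < arrival D s)
      \<or> (dest D p = orig D s \<and> arrival D p > departure D s))}"

definition valid_network :: "('i, 'n, 'g, 's) network \<Rightarrow> bool" where
  "valid_network D \<longleftrightarrow>
     finite (hubs D) \<and> finite (orders D) \<and> finite (comps D) \<and> finite (services D) \<and>
     (\<forall>n\<in>orders D. order_hub D n \<in> dc_hubs D) \<and>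
     (\<forall>g\<in>comps D. comp_hub D g \<in> dc_hubs D) \<and>
     (\<forall>s\<in>services D. orig D s \<in> hubs D - sat_hubs D \<and> dest D s \<in> hubs D)"

text \<open>What the words cost, weight and distance stand for. The triangle inequality is what makes
  the relaxation constraints and the optimality cuts valid. Positive distances between distinct
  orders rule out zero-length subtours, which the big-M constraints would not eliminate and on
  which tardiness would not be counted. A positive fixed cost on the last leg ensures that an
  optimal master solution never opens a service that delivers no order, for which the routing
  subproblem would be infeasible. Distances need not be symmetric.\<close>

definition cost_conditions :: "('i, 'n, 'g, 's) network \<Rightarrow> bool" where
  "cost_conditions D \<longleftrightarrow>
     (\<forall>n\<in>orders D. weight D n \<ge> 0) \<and>
     (\<forall>s\<in>services D. c_travel D s \<ge> 0 \<and> c_fixed D s \<ge> 0) \<and>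
     (\<forall>s\<in>sat_services D. c_fixed D s > 0) \<and>
     (\<forall>n\<in>orders D. \<forall>m\<in>orders D. n \<noteq> m \<longrightarrow> c_oo D n m > 0) \<and>
     (\<forall>l\<in>sat_hubs D. \<forall>n\<in>orders D. c_ho D l n \<ge> 0) \<and>
     (\<forall>n\<in>orders D. \<forall>m\<in>orders D. \<forall>k\<in>orders D. n \<noteq> m \<and> m \<noteq> k \<and> n \<noteq> k \<longrightarrow>
        c_oo D n k \<le> c_oo D n m + c_oo D m k) \<and>
     (\<forall>l\<in>sat_hubs D. \<forall>n\<in>orders D. \<forall>m\<in>orders D. n \<noteq> m \<longrightarrow>
        c_ho D l n \<le> c_ho D l m + c_oo D m n)"

section \<open>Intermodal constraints\<close>

text \<open>All decision variables are real-valued functions; integrality is a constraint. Values outside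
  the index sets of the model are never constrained.\<close>

record ('n, 'g, 's) plan =
  xv :: "'g \<Rightarrow> 's \<Rightarrow> real"
  ev :: "'g \<Rightarrow> real"
  Ev :: "'g \<Rightarrow> real"
  vv :: "'s \<Rightarrow> real"
  Vv :: "'s \<Rightarrow> real"
  yv :: "'n \<Rightarrow> 'g \<Rightarrow> real"
  hv :: "'n \<Rightarrow> 's \<Rightarrow> real"

definition plan_domains :: "('i, 'n, 'g, 's) network \<Rightarrow> ('n, 'g, 's) plan \<Rightarrow> bool" where
  "plan_domains D X \<longleftrightarrow>
     (\<forall>g\<in>comps D. \<forall>s\<in>services D. xv X g s \<in> {0, 1}) \<and>
     (\<forall>n\<in>orders D. \<forall>g\<in>comps D. yv X n g \<in> {0, 1}) \<and>
     (\<forall>g\<in>comps D. ev X g \<in> {0, 1}) \<and>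
     (\<forall>s\<in>services D. vv X s \<in> {0, 1}) \<and>
     (\<forall>n\<in>orders D. \<forall>s\<in>sat_services D. hv X n s \<in> {0, 1}) \<and>
     (\<forall>g\<in>comps D. Ev X g \<in> \<int> \<and> 0 \<le> Ev X g \<and> Ev X g \<le> comp_cap D) \<and>
     (\<forall>s\<in>services D. Vv X s \<in> \<int> \<and> 0 \<le> Vv X s \<and> Vv X s \<le> serv_cap D s) \<and>
     (\<forall>n\<in>orders D. \<forall>g\<in>comps D. order_hub D n \<noteq> comp_hub D g \<longrightarrow> yv X n g = 0)"

definition intermodal_feasible :: "('i, 'n, 'g, 's) network \<Rightarrow> ('n, 'g, 's) plan \<Rightarrow> bool" where
  "intermodal_feasible D X \<longleftrightarrow>
     plan_domains D X \<and>
     (\<forall>n\<in>orders D. (\<Sum>g\<in>comps D. yv X n g) = 1) \<and>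
     (\<forall>g\<in>comps D. Ev X g = (\<Sum>n\<in>orders D. quantity D n * yv X n g)) \<and>
     (\<forall>g\<in>comps D. \<forall>n\<in>orders D. ev X g \<ge> yv X n g) \<and>
     (\<forall>j\<in>dc_hubs D. \<forall>g\<in>comps D. comp_hub D g = j \<longrightarrow>
        (\<Sum>s\<in>out_services D j. xv X g s) = ev X g) \<and>
     (\<forall>j\<in>dc_hubs D. \<forall>g\<in>comps D. comp_hub D g = j \<longrightarrow>
        (\<forall>i\<in>hubs D - (sat_hubs D \<union> {j}).
           (\<Sum>s\<in>out_services D i. xv X g s) - (\<Sum>s\<in>in_services D i. xv X g s) = 0)) \<and>
     (\<forall>g\<in>comps D. (\<Sum>l\<in>sat_hubs D. \<Sum>s\<in>in_services D l. xv X g s) = ev X g) \<and>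
     (\<forall>g\<in>comps D. \<forall>s\<in>services D. \<forall>t\<in>conflicts D s. xv X g s + xv X g t \<le> 1) \<and>
     (\<forall>s\<in>services D. Vv X s = (\<Sum>g\<in>comps D. xv X g s)) \<and>
     (\<forall>s\<in>services D. \<forall>g\<in>comps D. vv X s \<ge> xv X g s) \<and>
     (\<forall>n\<in>orders D. \<forall>g\<in>comps D. \<forall>s\<in>sat_services D. hv X n s + 1 \<ge> xv X g s + yv X n g)"

definition transport_cost :: "('i, 'n, 'g, 's) network \<Rightarrow> ('n, 'g, 's) plan \<Rightarrow> real" where
  "transport_cost D X = (\<Sum>s\<in>services D. c_travel D s * Vv X s + c_fixed D s * vv X s)"

section \<open>The full problem\<close>

text \<open>\<open>arc s n m\<close> is $\gamma_{snm}$, \<open>arc_in s l n\<close> is $\gamma^+_{sln}$ (\<open>n\<close> is the first order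
  visited after hub \<open>l\<close>) and \<open>arc_out s l n\<close> is $\gamma^-_{sln}$ (\<open>n\<close> is the last one).\<close>

record ('i, 'n, 's) routing =
  arc :: "'s \<Rightarrow> 'n \<Rightarrow> 'n \<Rightarrow> real"
  arc_in :: "'s \<Rightarrow> 'i \<Rightarrow> 'n \<Rightarrow> real"
  arc_out :: "'s \<Rightarrow> 'i \<Rightarrow> 'n \<Rightarrow> real"
  compl :: "'s \<Rightarrow> 'n \<Rightarrow> real"
  cmax :: "'s \<Rightarrow> real"
  tard :: "'n \<Rightarrow> real"

definition routing_feasible ::
  "('i, 'n, 'g, 's) network \<Rightarrow> real \<Rightarrow> ('n, 'g, 's) plan \<Rightarrow> ('i, 'n, 's) routing \<Rightarrow> bool" where
  "routing_feasible D M X R \<longleftrightarrow>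
     (\<forall>n\<in>orders D. tard R n \<in> \<nat>) \<and>
     (\<forall>l\<in>sat_hubs D. \<forall>s\<in>in_services D l.
        cmax R s \<ge> 0 \<and>
        (\<forall>n\<in>orders D. compl R s n \<ge> 0 \<and> arc_in R s l n \<in> {0, 1} \<and> arc_out R s l n \<in> {0, 1}) \<and>
        (\<forall>n\<in>orders D. \<forall>m\<in>orders D - {n}. arc R s n m \<in> {0, 1}) \<and>
        (\<Sum>n\<in>orders D. arc_in R s l n) = vv X s \<and>
        (\<Sum>n\<in>orders D. arc_out R s l n) = vv X s \<and>
        (\<forall>n\<in>orders D.
           (\<Sum>m\<in>orders D - {n}. arc R s n m) + arc_out R s l n = hv X n s \<and>
           (\<Sum>m\<in>orders D - {n}. arc R s m n) + arc_in R s l n = hv X n s \<and>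
           arc_in R s l n \<le> hv X n s \<and>
           arc_out R s l n \<le> hv X n s \<and>
           arrival D s * hv X n s + c_ho D l n - compl R s n \<le> M * (1 - arc_in R s l n) \<and>
           tard R n \<ge> (compl R s n - due D n) / 24) \<and>
        (\<forall>n\<in>orders D. \<forall>m\<in>orders D - {n}.
           arc R s n m \<le> hv X n s \<and>
           arc R s n m \<le> hv X m s \<and>
           compl R s n + c_oo D n m - compl R s m \<le> M * (1 - arc R s n m)) \<and>
        cmax R s = (\<Sum>n\<in>orders D. \<Sum>m\<in>orders D - {n}. c_oo D n m * arc R s n m)
                   + (\<Sum>n\<in>orders D. c_ho D l n * arc_in R s l n))"

definition P_feasible ::
  "('i, 'n, 'g, 's) network \<Rightarrow> real \<Rightarrow> ('n, 'g, 's) plan \<times> ('i, 'n, 's) routing \<Rightarrow> bool" where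
  "P_feasible D M p \<longleftrightarrow> intermodal_feasible D (fst p) \<and> routing_feasible D M (fst p) (snd p)"

definition P_objective ::
  "('i, 'n, 'g, 's) network \<Rightarrow> ('n, 'g, 's) plan \<times> ('i, 'n, 's) routing \<Rightarrow> real" where
  "P_objective D p = transport_cost D (fst p) + (\<Sum>s\<in>sat_services D. cmax (snd p) s)
     + (\<Sum>n\<in>orders D. weight D n * tard (snd p) n)"

section \<open>Subproblems\<close>

definition active :: "('i, 'n, 'g, 's) network \<Rightarrow> ('n, 'g, 's) plan \<Rightarrow> 's set" where
  "active D X = {s \<in> sat_services D. vv X s = 1}"

definition assigned :: "('i, 'n, 'g, 's) network \<Rightarrow> ('n, 'g, 's) plan \<Rightarrow> 's \<Rightarrow> 'n set" where
  "assigned D X s = {n \<in> orders D. hv X n s = 1}"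

record ('i, 'n) subroute =
  sarc :: "'n \<Rightarrow> 'n \<Rightarrow> real"
  sarc_in :: "'i \<Rightarrow> 'n \<Rightarrow> real"
  sarc_out :: "'i \<Rightarrow> 'n \<Rightarrow> real"
  scompl :: "'n \<Rightarrow> real"
  scmax :: real
  stard :: "'n \<Rightarrow> real"
  szeta :: real

definition sub_feasible ::
  "('i, 'n, 'g, 's) network \<Rightarrow> real \<Rightarrow> 's \<Rightarrow> 'n set \<Rightarrow> ('i, 'n) subroute \<Rightarrow> bool" where
  "sub_feasible D M s H R \<longleftrightarrow> (let l = dest D s in
     scmax R \<ge> 0 \<and>
     (\<forall>n\<in>H. scompl R n \<ge> 0 \<and> stard R n \<in> \<nat> \<and> sarc_in R l n \<in> {0, 1} \<and> sarc_out R l n \<in> {0, 1}) \<and>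
     (\<forall>n\<in>H. \<forall>m\<in>H - {n}. sarc R n m \<in> {0, 1}) \<and>
     (\<Sum>n\<in>H. sarc_in R l n) = 1 \<and>
     (\<Sum>n\<in>H. sarc_out R l n) = 1 \<and>
     (\<forall>n\<in>H.
        (\<Sum>m\<in>H - {n}. sarc R n m) + sarc_out R l n = 1 \<and>
        (\<Sum>m\<in>H - {n}. sarc R m n) + sarc_in R l n = 1 \<and>
        arrival D s + c_ho D l n - scompl R n \<le> M * (1 - sarc_in R l n) \<and>
        stard R n \<ge> (scompl R n - due D n) / 24) \<and>
     (\<forall>n\<in>H. \<forall>m\<in>H - {n}. scompl R n + c_oo D n m - scompl R m \<le> M * (1 - sarc R n m)) \<and>
     scmax R = (\<Sum>n\<in>H. \<Sum>m\<in>H - {n}. c_oo D n m * sarc R n m)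
               + (\<Sum>n\<in>H. c_ho D l n * sarc_in R l n) \<and>
     szeta R \<ge> scmax R + (\<Sum>n\<in>H. weight D n * stard R n))"

definition sub_values ::
  "('i, 'n, 'g, 's) network \<Rightarrow> real \<Rightarrow> ('n, 'g, 's) plan \<Rightarrow> ('s \<Rightarrow> real) \<Rightarrow> bool" where
  "sub_values D M X \<zeta> \<longleftrightarrow>
     (\<forall>s\<in>active D X. \<exists>R. is_arg_min szeta (sub_feasible D M s (assigned D X s)) R \<and> \<zeta> s = szeta R)"

section \<open>Master problem with optimality cuts\<close>

text \<open>A cut generated in round \<open>r\<close> is recorded as the plan $\hat{x}_{r-1}$ together with the
  subproblem values $\zeta^r$; it is entry \<open>r - 1\<close> of the list of cuts. The variable
  \<open>mzr k s\<close> is $z^{k+1}_s$.\<close>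

type_synonym ('n, 'g, 's) cut = "('n, 'g, 's) plan \<times> ('s \<Rightarrow> real)"

record ('n, 'g, 's) master =
  mplan :: "('n, 'g, 's) plan"
  mz :: real
  mcstar :: "'s \<Rightarrow> real"
  mtstar :: "'n \<Rightarrow> real"
  mzr :: "nat \<Rightarrow> 's \<Rightarrow> real"

definition c_min :: "('i, 'n, 'g, 's) network \<Rightarrow> 'n \<Rightarrow> real" where
  "c_min D n = Min ((\<lambda>m. c_oo D m n) ` (orders D - {n}) \<union> (\<lambda>l. c_ho D l n) ` sat_hubs D)"

definition cut_satisfied ::
  "('i, 'n, 'g, 's) network \<Rightarrow> ('n, 'g, 's) cut \<Rightarrow> ('n, 'g, 's) plan \<Rightarrow> real \<Rightarrow> ('s \<Rightarrow> real) \<Rightarrow> bool" where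
  "cut_satisfied D c X z zr \<longleftrightarrow> (case c of (X', \<zeta>) \<Rightarrow>
     (\<forall>s\<in>active D X'. zr s \<ge> 0 \<and>
        zr s \<ge> \<zeta> s - \<zeta> s * (real (card (assigned D X' s)) - (\<Sum>n\<in>assigned D X' s. hv X n s))) \<and>
     z \<ge> (\<Sum>s\<in>active D X'. zr s) + transport_cost D X)"

definition master_feasible ::
  "('i, 'n, 'g, 's) network \<Rightarrow> ('n, 'g, 's) cut list \<Rightarrow> ('n, 'g, 's) master \<Rightarrow> bool" where
  "master_feasible D cuts m \<longleftrightarrow> (let X = mplan m in
     intermodal_feasible D X \<and>
     mz m \<ge> transport_cost D X \<and>
     (\<forall>n\<in>orders D. mtstar m n \<in> \<nat>) \<and>
     (\<forall>s\<in>sat_services D. mcstar m s \<ge> (\<Sum>n\<in>orders D. c_min D n * hv X n s)) \<and>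
     (\<forall>n\<in>orders D. \<forall>l\<in>sat_hubs D. \<forall>s\<in>in_services D l.
        mtstar m n \<ge> (arrival D s + c_ho D l n - due D n) / 24 * hv X n s) \<and>
     mz m \<ge> transport_cost D X + (\<Sum>n\<in>orders D. weight D n * mtstar m n)
             + (\<Sum>s\<in>sat_services D. mcstar m s) \<and>
     (\<forall>k<length cuts. cut_satisfied D (cuts ! k) X (mz m) (mzr m k)))"

definition master_optimal ::
  "('i, 'n, 'g, 's) network \<Rightarrow> ('n, 'g, 's) cut list \<Rightarrow> ('n, 'g, 's) master \<Rightarrow> bool" where
  "master_optimal D cuts m \<longleftrightarrow> is_arg_min mz (master_feasible D cuts) m"

section \<open>The algorithm\<close>

text \<open>The state at the loop test after round \<open>r = length (st_cuts \<sigma>)\<close>: the cuts added so far, the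
  current plan $\hat{x}$, its master value $\hat{z}$, and $\epsilon^r(\hat{x})$. Whenever a problem
  has several optimal solutions any of them may be returned, so the algorithm is a transition
  relation.\<close>

record ('n, 'g, 's) lbbd_state =
  st_cuts :: "('n, 'g, 's) cut list"
  st_plan :: "('n, 'g, 's) plan"
  st_z :: real
  st_eps :: real

definition lbbd_continue :: "('i, 'n, 'g, 's) network \<Rightarrow> ('n, 'g, 's) lbbd_state \<Rightarrow> bool" where
  "lbbd_continue D \<sigma> \<longleftrightarrow> transport_cost D (st_plan \<sigma>) + st_eps \<sigma> > st_z \<sigma>"

text \<open>The initial \<open>\<epsilon>0\<close> is an arbitrary positive number whose only role is to make the loop be
  entered; a run that skipped the loop would just return the value of the relaxation.\<close>

definition lbbd_init ::
  "('i, 'n, 'g, 's) network \<Rightarrow> real \<Rightarrow> ('n, 'g, 's) lbbd_state \<Rightarrow> bool" where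
  "lbbd_init D \<epsilon>0 \<sigma> \<longleftrightarrow>
     \<epsilon>0 > 0 \<and>
     (\<exists>m. master_optimal D [] m \<and>
        \<sigma> = \<lparr>st_cuts = [], st_plan = mplan m, st_z = mz m, st_eps = \<epsilon>0\<rparr>) \<and>
     lbbd_continue D \<sigma>"

text \<open>In the loop test both $f(\hat{x})$ and $\epsilon^r(\hat{x})$ refer to the current plan: after
  the first round \<open>st_eps\<close> is the sum of the optimal values of the subproblems of \<open>st_plan\<close>.\<close>

definition lbbd_step ::
  "('i, 'n, 'g, 's) network \<Rightarrow> real \<Rightarrow> ('n, 'g, 's) lbbd_state \<Rightarrow> ('n, 'g, 's) lbbd_state \<Rightarrow> bool" where
  "lbbd_step D M \<sigma> \<tau> \<longleftrightarrow>
     lbbd_continue D \<sigma> \<and>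
     (\<exists>\<zeta> m \<zeta>'.
        sub_values D M (st_plan \<sigma>) \<zeta> \<and>
        master_optimal D (st_cuts \<sigma> @ [(st_plan \<sigma>, \<zeta>)]) m \<and>
        sub_values D M (mplan m) \<zeta>' \<and>
        \<tau> = \<lparr>st_cuts = st_cuts \<sigma> @ [(st_plan \<sigma>, \<zeta>)], st_plan = mplan m, st_z = mz m,
             st_eps = (\<Sum>s\<in>active D (mplan m). \<zeta>' s)\<rparr>)"

text \<open>The master constraints bound $h_{ns}$ only from below, so a master solution may leave
  $h_{ns} = 1$ on a service that is not used ($v_s = 0$). The algorithm ignores such entries,
  and the full problem forbids them.\<close>

definition drop_unused :: "('n, 'g, 's) plan \<Rightarrow> ('n, 'g, 's) plan" where
  "drop_unused X = X\<lparr>hv := (\<lambda>n s. hv X n s * vv X s)\<rparr>"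

end

theory Submission
  imports Defs
begin

text \<open>For large \<open>M\<close> a subproblem solution is a Hamiltonian path through its orders and, conversely,
  every path extends to a solution; so optimal values are minima over finitely many lists and, by
  the triangle inequality, monotone in the set of orders. Hence every cut holds at some plan that
  costs no more than a given solution of the full problem, and the master value is a lower bound.
  At termination the routes of the subproblems complete the current plan to a solution of the full
  problem whose cost attains that bound. The loop test compares the bound with a cost that depends
  only on finitely many binary values of the plan, and the cut of a repeated plan makes it fail, so
  the loop ends.\<close>

section \<open>Routes as lists\<close>

text \<open>The main obstacle is that the master constrains \<open>hv\<close> only from below, so
  its plans may leave one order on several open services. The full problem charges the tardiness of
  an order once, the subproblems charge it once per service. The two bounds treat this mismatch
  differently. For the lower bound, the plan of a given solution is replaced by one that keeps each
  order only on the service that really carries it. For the upper bound, the routes of the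
  subproblems are glued together with a tardiness equal to the sum of the delays over all visits;
  tardiness is bounded only from below, so this is feasible, and its cost is exactly the transport
  cost plus the subproblem values, the quantity compared in the loop test. A second difficulty is
  attainment of minima. Continuous variables, and values outside the index sets, allow infinitely
  many solutions, so each problem is first reduced to finitely many attained candidate
  values.\<close>

fun edges :: "'n list \<Rightarrow> ('n \<times> 'n) set" where
  "edges (x # y # zs) = insert (x, y) (edges (y # zs))"
| "edges _ = {}"

text \<open>The entry leg is a function \<open>f\<close> of the first order, so that after
  \<open>x\<close> the tail is again a route, entered through \<open>c x\<close>. Inductions
  therefore generalise over \<open>f\<close>.\<close>

primrec path_length :: "('n \<Rightarrow> 'n \<Rightarrow> real) \<Rightarrow> ('n \<Rightarrow> real) \<Rightarrow> 'n list \<Rightarrow> real" where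
  "path_length c f [] = 0"
| "path_length c f (x # xs) = f x + path_length c (c x) xs"

text \<open>Here \<open>f\<close> gives the time at which an order would be reached if it came
  first. The default 0 for absent orders matters later: the full problem constrains completion times
  also on services that do not visit the order.\<close>

primrec visit :: "('n \<Rightarrow> 'n \<Rightarrow> real) \<Rightarrow> ('n \<Rightarrow> real) \<Rightarrow> 'n list \<Rightarrow> 'n \<Rightarrow> real" where
  "visit c f [] = (\<lambda>_. 0)"
| "visit c f (x # xs) = (\<lambda>n. if n = x then f x else visit c (\<lambda>m. f x + c x m) xs n)"

lemma edges_in_set: "(n, m) \<in> edges ns \<Longrightarrow> n \<in> set ns \<and> m \<in> set ns"
  by (induction ns rule: edges.induct) auto

lemma edges_not_into_hd: "distinct (x # xs) \<Longrightarrow> (n, x) \<notin> edges (x # xs)"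
  by (cases xs) (auto dest: edges_in_set)

lemma edges_neq: "distinct ns \<Longrightarrow> (n, m) \<in> edges ns \<Longrightarrow> n \<noteq> m"
  by (induction ns rule: edges.induct) auto

lemma edges_snoc: "ns \<noteq> [] \<Longrightarrow> edges (ns @ [m]) = insert (last ns, m) (edges ns)"
  by (induction ns rule: edges.induct) auto

lemma edges_next: "n \<in> set ns \<Longrightarrow> n \<noteq> last ns \<Longrightarrow> \<exists>m. (n, m) \<in> edges ns"
  by (induction ns rule: edges.induct) (auto split: if_splits)

text \<open>The ambient set may exceed the route: \<open>A = set ns\<close> yields the flow
  constraints of a subproblem, \<open>A = orders D\<close> those of the full problem, where an empty
  route must give flow 0.\<close>

lemma sum_edges_out:
  assumes "distinct ns" "set ns \<subseteq> A" "finite A" "n \<in> A"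
  shows "(\<Sum>m\<in>A - {n}. of_bool ((n, m) \<in> edges ns)) + of_bool (ns \<noteq> [] \<and> n = last ns)
    = (of_bool (n \<in> set ns) :: real)"
  using assms
proof (induction ns rule: edges.induct)
  case (1 x y zs)
  have IH: "(\<Sum>m\<in>A - {n}. of_bool ((n, m) \<in> edges (y # zs))) + of_bool (n = last (y # zs))
    = (of_bool (n \<in> set (y # zs)) :: real)"
    using 1 by simp
  show ?case
  proof (cases "n = x")
    case True
    have "(n, m) \<in> edges (x # y # zs) \<longleftrightarrow> m = y" for m
      using 1(2) True by (auto dest: edges_in_set)
    moreover have "(\<Sum>m\<in>A - {n}. of_bool (m = y)) = (1::real)"
      using 1 True by (auto simp: of_bool_def)
    ultimately have "(\<Sum>m\<in>A - {n}. of_bool ((n, m) \<in> edges (x # y # zs))) = (1::real)"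
      by (simp only:)
    moreover have "last (y # zs) \<noteq> x" using 1(2) last_in_set[of "y # zs"] by (auto simp del: last_in_set)
    ultimately show ?thesis using True by simp
  next
    case False
    then have "(n, m) \<in> edges (x # y # zs) \<longleftrightarrow> (n, m) \<in> edges (y # zs)" for m by simp
    then show ?thesis using IH False by simp
  qed
qed (auto simp: of_bool_def)

lemma sum_edges_in:
  assumes "distinct ns" "set ns \<subseteq> A" "finite A" "n \<in> A"
  shows "(\<Sum>m\<in>A - {n}. of_bool ((m, n) \<in> edges ns)) + of_bool (ns \<noteq> [] \<and> n = hd ns)
    = (of_bool (n \<in> set ns) :: real)"
  using assms
proof (induction ns rule: edges.induct)
  case (1 x y zs)
  have IH: "(\<Sum>m\<in>A - {n}. of_bool ((m, n) \<in> edges (y # zs))) + of_bool (n = y)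
    = (of_bool (n \<in> set (y # zs)) :: real)"
    using 1 by simp
  \<comment> \<open>Without \<open>x\<close> the order \<open>y\<close> comes first, so in the tail
    its entry indicator stands where the longer list has the arc from \<open>x\<close>. Hence
    \<open>y\<close> is counted directly.\<close>
  consider "n = x" | "n = y" "n \<noteq> x" | "n \<noteq> x" "n \<noteq> y" by blast
  then show ?case
  proof cases
    case 1
    then have "(m, n) \<notin> edges (x # y # zs)" for m
      using edges_not_into_hd[OF "1.prems"(1)] by simp
    then show ?thesis using 1 by simp
  next
    case 2
    then have "(m, n) \<in> edges (x # y # zs) \<longleftrightarrow> m = x" for m
      using edges_not_into_hd[of y zs m] "1.prems"(1) by simp
    moreover have "(\<Sum>m\<in>A - {n}. of_bool (m = x)) = (1::real)"
      using "1.prems" 2 by (auto simp: of_bool_def)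
    ultimately have "(\<Sum>m\<in>A - {n}. of_bool ((m, n) \<in> edges (x # y # zs))) = (1::real)"
      by (simp only:)
    then show ?thesis using 2 by simp
  next
    case 3
    then have "(m, n) \<in> edges (x # y # zs) \<longleftrightarrow> (m, n) \<in> edges (y # zs)" for m by auto
    then show ?thesis using IH 3 by simp
  qed
qed (auto simp: of_bool_def)

text \<open>When \<open>x\<close> is removed, the arc from \<open>x\<close> to \<open>y\<close>
  turns into the entry leg of the tail, so the induction hypothesis is taken at
  \<open>c x\<close>.\<close>

lemma path_length_eq_sum:
  assumes "distinct ns" "set ns \<subseteq> A" "finite A"
  shows "(\<Sum>n\<in>A. \<Sum>m\<in>A - {n}. c n m * of_bool ((n, m) \<in> edges ns))
    + (\<Sum>n\<in>A. f n * of_bool (ns \<noteq> [] \<and> n = hd ns)) = path_length c f ns"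
  using assms
proof (induction ns arbitrary: f rule: edges.induct)
  case (1 x y zs)
  have "of_bool ((n, m) \<in> edges (x # y # zs))
      = of_bool (m = y \<and> n = x) + (of_bool ((n, m) \<in> edges (y # zs)) :: real)" for n m
    using "1.prems"(1) by (auto dest: edges_in_set)
  then have "(\<Sum>n\<in>A. \<Sum>m\<in>A - {n}. c n m * of_bool ((n, m) \<in> edges (x # y # zs)))
      = (\<Sum>n\<in>A. \<Sum>m\<in>A - {n}. c n m * of_bool (m = y \<and> n = x))
      + (\<Sum>n\<in>A. \<Sum>m\<in>A - {n}. c n m * of_bool ((n, m) \<in> edges (y # zs)))"
    by (simp only: distrib_left sum.distrib)
  moreover have "(\<Sum>n\<in>A. \<Sum>m\<in>A - {n}. c n m * of_bool (m = y \<and> n = x)) = c x y"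
  proof -
    have "(\<Sum>m\<in>A - {n}. c n m * of_bool (m = y \<and> n = x)) = (if n = x then c x y else 0)"
      if "n \<in> A" for n
      using that "1.prems"
      by (auto simp: of_bool_def if_distrib [of "\<lambda>u. _ * u"] sum.delta cong: if_cong)
    then show ?thesis using "1.prems" by (simp add: sum.delta')
  qed
  moreover have "(\<Sum>n\<in>A. g n * of_bool (n = u)) = g u" if "u \<in> A" for g :: "'a \<Rightarrow> real" and u
    using that "1.prems" by (simp add: of_bool_def if_distrib[of "\<lambda>u. _ * u"] sum.delta' cong: if_cong)
  ultimately show ?case using "1.IH"[of "c x"] "1.prems" by simp
next
  case ("2_2" v)
  then show ?case
    by (simp add: of_bool_def if_distrib[of "\<lambda>u. _ * u"] sum.delta' cong: if_cong)
qed auto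

text \<open>Every order is entered through exactly one leg. With \<open>g = c_min D\<close> this
  gives the distance relaxation of the master, with the constant 0 the nonnegativity of route
  lengths.\<close>

lemma path_length_ge_sum:
  assumes "distinct ns" "\<And>n. n \<in> set ns \<Longrightarrow> g n \<le> f n"
    and "\<And>n m. n \<in> set ns \<Longrightarrow> m \<in> set ns \<Longrightarrow> n \<noteq> m \<Longrightarrow> g m \<le> c n m"
  shows "sum g (set ns) \<le> path_length c f ns"
  using assms
proof (induction ns arbitrary: f)
  case (Cons x xs)
  have "sum g (set xs) \<le> path_length c (c x) xs"
    by (rule Cons.IH) (use Cons.prems in auto)
  then show ?case using Cons.prems(1) Cons.prems(2)[of x] by simp
qed simp

lemma path_length_detour:
  assumes "0 \<le> f y" and "\<And>z. z \<in> set zs \<Longrightarrow> f z \<le> f y + c y z"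
  shows "path_length c f zs \<le> f y + path_length c (c y) zs"
  using assms by (cases zs) auto

text \<open>A deleted head is absorbed by \<open>path_length_detour\<close>. The triangle inequality
  for \<open>f\<close> covers deletions at the front; for the tail it becomes the triangle
  inequality of \<open>c\<close> at \<open>x\<close>.\<close>

lemma path_length_filter:
  assumes "distinct ns" "\<And>n. n \<in> set ns \<Longrightarrow> 0 \<le> f n"
    and "\<And>n m. n \<in> set ns \<Longrightarrow> m \<in> set ns \<Longrightarrow> n \<noteq> m \<Longrightarrow> 0 \<le> c n m"
    and "\<And>n m. n \<in> set ns \<Longrightarrow> m \<in> set ns \<Longrightarrow> n \<noteq> m \<Longrightarrow> f m \<le> f n + c n m"
    and "\<And>n m k. n \<in> set ns \<Longrightarrow> m \<in> set ns \<Longrightarrow> k \<in> set ns \<Longrightarrow> n \<noteq> m \<Longrightarrow> m \<noteq> k \<Longrightarrow> n \<noteq> k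
      \<Longrightarrow> c n k \<le> c n m + c m k"
  shows "path_length c f (filter P ns) \<le> path_length c f ns"
  using assms
proof (induction ns arbitrary: f)
  case (Cons x xs)
  have IH: "path_length c (c x) (filter P xs) \<le> path_length c (c x) xs"
  proof (rule Cons.IH)
    show "c x m \<le> c x n + c n m" if "n \<in> set xs" "m \<in> set xs" "n \<noteq> m" for n m
      using Cons.prems(1) that by (intro Cons.prems(5)) auto
  qed (use Cons.prems in auto)
  have "path_length c f (filter P xs) \<le> f x + path_length c (c x) (filter P xs)"
  proof (rule path_length_detour)
    show "f z \<le> f x + c x z" if "z \<in> set (filter P xs)" for z
      using Cons.prems(1) that by (intro Cons.prems(4)) auto
  qed (use Cons.prems in auto)
  then show ?case using IH by simp
qed simp

section \<open>Visiting times along a route\<close>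

lemma visit_outside: "n \<notin> set ns \<Longrightarrow> visit c f ns n = 0"
  by (induction ns arbitrary: f) auto

lemma visit_edge: "distinct ns \<Longrightarrow> (n, m) \<in> edges ns \<Longrightarrow> visit c f ns m = visit c f ns n + c n m"
  by (induction ns arbitrary: f rule: edges.induct) (auto dest: edges_in_set)

lemma visit_nonneg:
  assumes "distinct ns" "\<And>n. n \<in> set ns \<Longrightarrow> 0 \<le> f n"
    and "\<And>n m. n \<in> set ns \<Longrightarrow> m \<in> set ns \<Longrightarrow> n \<noteq> m \<Longrightarrow> 0 \<le> c n m"
  shows "0 \<le> visit c f ns n"
  using assms
proof (induction ns arbitrary: f)
  case (Cons x xs)
  have "0 \<le> visit c (\<lambda>m. f x + c x m) xs n"
    by (rule Cons.IH) (use Cons.prems in \<open>auto intro!: add_nonneg_nonneg\<close>)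
  then show ?case using Cons.prems(2)[of x] by simp
qed simp

text \<open>The first leg ends by time \<open>F\<close> and each later leg adds at most
  \<open>K\<close>; in the induction the tail is entered with \<open>F + K\<close>.\<close>

lemma visit_upper:
  assumes "0 \<le> F" "0 \<le> K" "\<And>n. n \<in> set ns \<Longrightarrow> f n \<le> F"
    and "\<And>n m. n \<in> set ns \<Longrightarrow> m \<in> set ns \<Longrightarrow> c n m \<le> K"
  shows "visit c f ns n \<le> F + K * real (length ns)"
  using assms
proof (induction ns arbitrary: f F)
  case (Cons x xs)
  have "visit c (\<lambda>m. f x + c x m) xs n \<le> (F + K) + K * real (length xs)"
    by (rule Cons.IH) (use Cons.prems in \<open>auto intro!: add_mono\<close>)
  moreover have "f x \<le> F" "0 \<le> K * real (length xs)" "0 \<le> K"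
    using Cons.prems by auto
  moreover have "K * real (length (x # xs)) = K + K * real (length xs)"
    by (simp add: algebra_simps)
  ultimately have "visit c (\<lambda>m. f x + c x m) xs n \<le> F + K * real (length (x # xs))"
    and "f x \<le> F + K * real (length (x # xs))"
    by linarith+
  then show ?case by (simp del: length_Cons)
qed simp

text \<open>The relation is required for all pairs of positions rather than for neighbours, so that
  it survives the deletion of orders. Any order may then become the first, which explains the
  condition on \<open>f\<close> for all of \<open>ns\<close>.\<close>

lemma visit_le:
  assumes "sorted_wrt (\<lambda>n m. C n + c n m \<le> C m) ns" "\<And>n. n \<in> set ns \<Longrightarrow> f n \<le> C n"
    and "n \<in> set ns"
  shows "visit c f ns n \<le> C n"
  using assms
proof (induction ns arbitrary: f)
  case (Cons x xs)
  show ?case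
  proof (cases "n = x")
    case False
    have "visit c (\<lambda>m. f x + c x m) xs n \<le> C n"
    proof (rule Cons.IH)
      show "f x + c x m \<le> C m" if "m \<in> set xs" for m
        using Cons.prems(1) Cons.prems(2)[of x] that by fastforce
    qed (use Cons.prems False in auto)
    then show ?thesis using False by simp
  qed (use Cons.prems in auto)
qed simp

text \<open>The triangle inequality carries the timing constraints from consecutive orders to
  distant ones, which is the form that \<open>visit_le\<close> needs.\<close>

lemma sorted_wrt_of_edges:
  fixes C :: "'n \<Rightarrow> real"
  assumes "distinct ns" "\<And>n m. (n, m) \<in> edges ns \<Longrightarrow> C n + c n m \<le> C m"
    and "\<And>n m k. n \<in> set ns \<Longrightarrow> m \<in> set ns \<Longrightarrow> k \<in> set ns \<Longrightarrow> n \<noteq> m \<Longrightarrow> m \<noteq> k \<Longrightarrow> n \<noteq> k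
      \<Longrightarrow> c n k \<le> c n m + c m k"
  shows "sorted_wrt (\<lambda>n m. C n + c n m \<le> C m) ns"
  using assms
proof (induction ns rule: edges.induct)
  case (1 x y zs)
  have IH: "sorted_wrt (\<lambda>n m. C n + c n m \<le> C m) (y # zs)"
    by (rule "1.IH") (use "1.prems" in auto)
  have xy: "C x + c x y \<le> C y" using "1.prems"(2) by simp
  have "C x + c x z \<le> C z" if "z \<in> set zs" for z
  proof -
    have "c x z \<le> c x y + c y z" using "1.prems"(1) that by (intro "1.prems"(3)) auto
    moreover have "C y + c y z \<le> C z" using IH that by simp
    ultimately show ?thesis using xy by linarith
  qed
  then show ?case using IH xy by simp
qed auto

section \<open>Hamiltonian paths from flow variables\<close>

lemma binary_sum_unique:
  fixes a :: "'a \<Rightarrow> real"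
  assumes "finite A" "\<And>x. x \<in> A \<Longrightarrow> a x \<in> {0, 1}" "sum a A \<le> 1"
    and "x \<in> A" "y \<in> A" "a x = 1" "a y = 1"
  shows "x = y"
proof (rule ccontr)
  assume "x \<noteq> y"
  have "sum a {x, y} \<le> sum a A" using assms by (intro sum_mono2) fastforce+
  then show False using \<open>x \<noteq> y\<close> assms by simp
qed

lemma binary_sum_witness:
  fixes a :: "'a \<Rightarrow> real"
  assumes "\<And>x. x \<in> A \<Longrightarrow> a x \<in> {0, 1}" "sum a A \<noteq> 0"
  obtains x where "x \<in> A" "a x = 1"
  using assms by (metis empty_iff insert_iff sum.neutral)

text \<open>Arrival times strictly increase along chosen arcs, so a longest chain starting at the
  entry order is a Hamiltonian path: its end must be the exit, and an unvisited order of
  minimal time would have a visited predecessor with two successors.\<close>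

lemma hamiltonian_path:
  fixes C p q :: "'n \<Rightarrow> real" and a :: "'n \<Rightarrow> 'n \<Rightarrow> real"
  assumes fin: "finite H"
    and abin: "\<And>n m. n \<in> H \<Longrightarrow> m \<in> H - {n} \<Longrightarrow> a n m \<in> {0, 1}"
    and pbin: "\<And>n. n \<in> H \<Longrightarrow> p n \<in> {0, 1}" and qbin: "\<And>n. n \<in> H \<Longrightarrow> q n \<in> {0, 1}"
    and psum: "sum p H = 1"
    and out: "\<And>n. n \<in> H \<Longrightarrow> (\<Sum>m\<in>H - {n}. a n m) + q n = 1"
    and inc: "\<And>n. n \<in> H \<Longrightarrow> (\<Sum>m\<in>H - {n}. a m n) + p n = 1"
    and less: "\<And>n m. n \<in> H \<Longrightarrow> m \<in> H - {n} \<Longrightarrow> a n m = 1 \<Longrightarrow> C n < C m"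
  obtains ns where "distinct ns" "set ns = H" "ns \<noteq> []" "p (hd ns) = 1"
    "\<And>n m. (n, m) \<in> edges ns \<Longrightarrow> a n m = 1"
proof -
  define chain where "chain ns \<longleftrightarrow> ns \<noteq> [] \<and> set ns \<subseteq> H \<and> p (hd ns) = 1
    \<and> (\<forall>n m. (n, m) \<in> edges ns \<longrightarrow> a n m = 1) \<and> sorted_wrt (\<lambda>n m. C n < C m) ns" for ns
  \<comment> \<open>Strictly increasing times exclude repetitions, so chains have at most
    \<open>card H\<close> elements and a longest one exists.\<close>
  have chain_distinct: "distinct ns" if "chain ns" for ns
    using that unfolding chain_def distinct_conv_nth
    by (metis less_irrefl nat_neq_iff sorted_wrt_iff_nth_less)
  obtain n0 where n0: "n0 \<in> H" "p n0 = 1"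
    using binary_sum_witness[of H p] pbin psum by auto
  then have ex: "chain [n0]" by (simp add: chain_def)
  have bound: "length ns < Suc (card H)" if "chain ns" for ns
    using chain_distinct[OF that] that fin unfolding chain_def
    by (metis card_mono distinct_card le_imp_less_Suc)
  obtain ns where ns: "chain ns" and max: "\<And>xs. chain xs \<Longrightarrow> length xs \<le> length ns"
    using ex_has_greatest_nat[of chain, OF ex, of length "Suc (card H)"] bound by (auto dest: less_imp_le)
  have dist: "distinct ns" using chain_distinct[OF ns] .
  have sub: "set ns \<subseteq> H" "ns \<noteq> []" and inE: "last ns \<in> H"
    using ns last_in_set[of ns] by (auto simp: chain_def)
  have qlast: "q (last ns) = 1"
  proof (rule ccontr)
    assume "q (last ns) \<noteq> 1"
    then have "q (last ns) = 0" using qbin[OF inE] by auto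
    then obtain m where m: "m \<in> H - {last ns}" "a (last ns) m = 1"
      using binary_sum_witness[of "H - {last ns}" "a (last ns)"] abin[OF inE] out[OF inE] by auto
    have lm: "C (last ns) < C m" using less[OF inE m] .
    \<comment> \<open>Being later than everything on the chain, \<open>m\<close> can be appended,
      against maximality.\<close>
    have "C x < C m" if "x \<in> set ns" for x
    proof (cases "x = last ns")
      case False
      obtain bs z where bs: "ns = bs @ [z]" using sub by (cases ns rule: rev_cases) auto
      then have "C x < C (last ns)"
        using ns False that by (auto simp: chain_def sorted_wrt_append)
      then show ?thesis using lm by simp
    qed (use lm in simp)
    then have "chain (ns @ [m])"
      using ns m by (auto simp: chain_def sorted_wrt_append edges_snoc)
    then show False using max by fastforce
  qed
  have "H \<subseteq> set ns"
  proof (rule ccontr)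
    assume "\<not> H \<subseteq> set ns"
    then have ne: "H - set ns \<noteq> {}" by blast
    obtain n where n: "n \<in> H" "n \<notin> set ns" and least: "\<And>m. m \<in> H - set ns \<Longrightarrow> C n \<le> C m"
      using ex_min_if_finite[of "C ` (H - set ns)"] fin ne
      by (auto simp: not_less)
    have "p n \<noteq> 1"
      using binary_sum_unique[of H p n "hd ns"] fin pbin psum n ns sub hd_in_set[of ns]
      unfolding chain_def by (metis order_refl subsetD)
    then have "p n = 0" using pbin[OF n(1)] by auto
    then obtain k where k: "k \<in> H - {n}" "a k n = 1"
      using binary_sum_witness[of "H - {n}" "\<lambda>m. a m n"] abin n(1) inc[OF n(1)] by force
    have "C k < C n" using less[of k n] k n by auto
    then have kns: "k \<in> set ns" using least[of k] k by force
    show False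
    proof (cases "k = last ns")
      \<comment> \<open>The exit takes the whole unit of flow that leaves the last order, so no arc
        to \<open>n\<close> remains.\<close>
      case True
      then have "(\<Sum>m\<in>H - {k}. a k m) = 0" using out[OF inE] qlast by simp
      moreover have "a k n \<le> (\<Sum>m\<in>H - {k}. a k m)"
        using abin[of k] fin n k by (intro member_le_sum) force+
      ultimately show False using k by simp
    next
      case False
      then obtain m where km: "(k, m) \<in> edges ns" using edges_next[OF kns] by blast
      then have m: "m \<in> set ns" "m \<noteq> k" "a k m = 1"
        using edges_in_set[OF km] edges_neq[OF dist km] ns by (auto simp: chain_def)
      have "sum (a k) (H - {k}) \<le> 1" using out[of k] qbin[of k] k by auto
      then have "m = n"
        using binary_sum_unique[of "H - {k}" "a k" m n] fin abin[of k] m n k sub by auto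
      then show False using m n by simp
    qed
  qed
  then show ?thesis using that[of ns] dist sub ns by (auto simp: chain_def)
qed

section \<open>Rounded delays and attainment of minima\<close>

definition lateness :: "real \<Rightarrow> nat" where
  "lateness d = nat \<lceil>d / 24\<rceil>"

lemma lateness_ge: "d / 24 \<le> real (lateness d)"
  unfolding lateness_def by linarith

lemma lateness_le: "x \<in> \<nat> \<Longrightarrow> d / 24 \<le> x \<Longrightarrow> real (lateness d) \<le> x"
  by (auto simp: lateness_def Nats_def ceiling_le_iff nat_le_iff)

text \<open>An infimum over an infinite feasible set need not be attained. It is attained if
  finitely many attained values lie below all others in the sense that each feasible value dominates
  one of them.\<close>

lemma is_arg_min_candidates:
  fixes f :: "'a \<Rightarrow> real"
  assumes "finite V" "\<exists>x. P x"
    and "\<And>x. P x \<Longrightarrow> \<exists>v\<in>V. v \<le> f x"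
    and "\<And>v. v \<in> V \<Longrightarrow> \<exists>x. P x \<and> f x = v"
  shows "\<exists>x. is_arg_min f P x \<and> f x \<in> V"
proof -
  have "V \<noteq> {}" using assms(2,3) by blast
  then obtain x where x: "P x" "f x = Min V" using assms(1,4) Min_in by blast
  have "\<not> f y < f x" if "P y" for y
    using assms(3)[OF that] assms(1) x Min_le by fastforce
  then show ?thesis
    using x Min_in[OF assms(1) \<open>V \<noteq> {}\<close>] by (auto simp: is_arg_min_def)
qed

text \<open>If \<open>f\<close> factors through \<open>g\<close> on \<open>A\<close>, choosing one
  representative per fibre of \<open>g\<close> shows that \<open>f\<close> has no more values than
  \<open>g\<close>. It is applied to master values and plan signatures.\<close>

lemma finite_image_factor:
  assumes "finite (g ` A)" "\<And>x y. x \<in> A \<Longrightarrow> y \<in> A \<Longrightarrow> g x = g y \<Longrightarrow> f x = f y"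
  shows "finite (f ` A)"
proof -
  have "f ` A \<subseteq> (\<lambda>v. f (SOME x. x \<in> A \<and> g x = v)) ` g ` A"
  proof
    fix y assume "y \<in> f ` A"
    then obtain x where x: "x \<in> A" "y = f x" by blast
    define z where "z = (SOME z. z \<in> A \<and> g z = g x)"
    have "z \<in> A \<and> g z = g x" unfolding z_def by (rule someI[of _ x]) (use x in simp)
    then have "y = f z" using assms(2)[of z x] x by simp
    then show "y \<in> (\<lambda>v. f (SOME x. x \<in> A \<and> g x = v)) ` g ` A" using x by (auto simp: z_def)
  qed
  then show ?thesis using assms(1) finite_subset by blast
qed

section \<open>Routes and subproblems\<close>

text \<open>\<open>K\<close> bounds every single leg, the first one together with the arrival time.
  A route ends by \<open>K + card (orders D) * K\<close>, and a big-M constraint adds one more leg,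
  hence the factor \<open>card (orders D) + 2\<close>. The absolute value makes
  \<open>K_start\<close> bound \<open>c_ho\<close> alone too, as needed where \<open>hv\<close> is
  0.\<close>

locale delivery_network =
  fixes D :: "('i, 'n, 'g, 's) network" and K M :: real
  assumes valid: "valid_network D" and costs: "cost_conditions D"
    and K_nonneg: "0 \<le> K"
    and K_start: "\<And>s n. s \<in> sat_services D \<Longrightarrow> n \<in> orders D \<Longrightarrow>
      \<bar>arrival D s\<bar> + c_ho D (dest D s) n \<le> K"
    and K_dist: "\<And>n m. n \<in> orders D \<Longrightarrow> m \<in> orders D \<Longrightarrow> c_oo D n m \<le> K"
    and M_large: "(real (card (orders D)) + 2) * K \<le> M"
begin

lemma finite_sets [simp]:
  "finite (orders D)" "finite (comps D)" "finite (services D)" "finite (sat_services D)"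
  "finite (sat_hubs D)"
  using valid by (auto simp: valid_network_def sat_services_def hubs_def)

lemma weight_nonneg: "n \<in> orders D \<Longrightarrow> 0 \<le> weight D n"
  using costs by (simp add: cost_conditions_def)

lemma c_oo_pos: "n \<in> orders D \<Longrightarrow> m \<in> orders D \<Longrightarrow> n \<noteq> m \<Longrightarrow> 0 < c_oo D n m"
  using costs by (simp add: cost_conditions_def)

lemma c_oo_triangle:
  "n \<in> orders D \<Longrightarrow> m \<in> orders D \<Longrightarrow> k \<in> orders D \<Longrightarrow> n \<noteq> m \<Longrightarrow> m \<noteq> k \<Longrightarrow> n \<noteq> k \<Longrightarrow>
    c_oo D n k \<le> c_oo D n m + c_oo D m k"
  using costs by (simp add: cost_conditions_def)

lemma sat_hub: "s \<in> sat_services D \<Longrightarrow> dest D s \<in> sat_hubs D"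
  by (simp add: sat_services_def)

lemma sat_service: "s \<in> sat_services D \<Longrightarrow> s \<in> services D"
  by (simp add: sat_services_def)

lemma c_ho_nonneg: "s \<in> sat_services D \<Longrightarrow> n \<in> orders D \<Longrightarrow> 0 \<le> c_ho D (dest D s) n"
  using costs sat_hub by (simp add: cost_conditions_def)

lemma c_ho_triangle:
  "s \<in> sat_services D \<Longrightarrow> n \<in> orders D \<Longrightarrow> m \<in> orders D \<Longrightarrow> n \<noteq> m \<Longrightarrow>
    c_ho D (dest D s) m \<le> c_ho D (dest D s) n + c_oo D n m"
  using costs sat_hub by (simp add: cost_conditions_def)

text \<open>The hub index of such a constraint is determined by the service, so hub-service pairs
  collapse to services.\<close>

lemma ball_sat_services:
  "(\<forall>l\<in>sat_hubs D. \<forall>s\<in>in_services D l. Q l s) \<longleftrightarrow> (\<forall>s\<in>sat_services D. Q (dest D s) s)"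
  by (auto simp: in_services_def sat_services_def)

text \<open>The maximum with 0 accounts for the constraint that completion times are nonnegative,
  since arrival times may have any sign.\<close>

definition route_start :: "'s \<Rightarrow> 'n \<Rightarrow> real" where
  "route_start s n = max 0 (arrival D s + c_ho D (dest D s) n)"

definition route_times :: "'s \<Rightarrow> 'n list \<Rightarrow> 'n \<Rightarrow> real" where
  "route_times s = visit (c_oo D) (route_start s)"

definition route_length :: "'s \<Rightarrow> 'n list \<Rightarrow> real" where
  "route_length s = path_length (c_oo D) (c_ho D (dest D s))"

definition route_late :: "'s \<Rightarrow> 'n list \<Rightarrow> 'n \<Rightarrow> nat" where
  "route_late s ns n = lateness (route_times s ns n - due D n)"

definition route_cost :: "'s \<Rightarrow> 'n list \<Rightarrow> real" where
  "route_cost s ns = route_length s ns + (\<Sum>n\<in>set ns. weight D n * real (route_late s ns n))"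

lemma route_length_nonneg:
  assumes "s \<in> sat_services D" "distinct ns" "set ns \<subseteq> orders D"
  shows "0 \<le> route_length s ns"
proof -
  have "sum (\<lambda>_. 0) (set ns) \<le> route_length s ns"
    unfolding route_length_def
    by (rule path_length_ge_sum) (use assms c_ho_nonneg in \<open>auto intro!: less_imp_le[OF c_oo_pos]\<close>)
  then show ?thesis by simp
qed

lemma route_times_nonneg:
  assumes "distinct ns" "set ns \<subseteq> orders D"
  shows "0 \<le> route_times s ns n"
  unfolding route_times_def
  by (rule visit_nonneg) (use assms in \<open>auto simp: route_start_def intro!: less_imp_le[OF c_oo_pos]\<close>)

lemma route_times_upper:
  assumes "s \<in> sat_services D" "distinct ns" "set ns \<subseteq> orders D"
  shows "route_times s ns n + K \<le> M"
proof -
  have "route_times s ns n \<le> K + K * real (length ns)"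
    unfolding route_times_def
  proof (rule visit_upper)
    show "route_start s n \<le> K" if "n \<in> set ns" for n
      using K_start[OF assms(1), of n] that assms(3) K_nonneg by (auto simp: route_start_def)
  qed (use assms K_nonneg K_dist in auto)
  also have "\<dots> \<le> K + K * real (card (orders D))"
    using K_nonneg assms(2,3) card_mono[OF finite_sets(1) assms(3)]
    by (simp add: distinct_card mult_left_mono)
  finally show ?thesis using M_large by (simp add: algebra_simps)
qed

lemma K_le_M: "K \<le> M"
proof -
  have "1 * K \<le> (real (card (orders D)) + 2) * K" using K_nonneg by (intro mult_right_mono) auto
  then show ?thesis using M_large by simp
qed

text \<open>A chosen arc gives equality; otherwise \<open>M\<close> absorbs a full route plus one
  leg. Pairs off the route, with visiting time 0, are included because the full problem constrains
  all pairs.\<close>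

lemma route_times_edge_bigM:
  assumes "s \<in> sat_services D" "distinct ns" "set ns \<subseteq> orders D" "n \<in> orders D" "m \<in> orders D"
  shows "route_times s ns n + c_oo D n m - route_times s ns m
    \<le> M * (1 - of_bool ((n, m) \<in> edges ns))"
proof (cases "(n, m) \<in> edges ns")
  case True
  then show ?thesis using visit_edge[OF assms(2) True] by (simp add: route_times_def)
next
  case False
  then show ?thesis
    using route_times_upper[OF assms(1-3), of n] route_times_nonneg[OF assms(2,3), of s m]
      K_dist[OF assms(4,5)] by simp
qed

lemma route_times_start_bigM:
  assumes "s \<in> sat_services D" "distinct ns" "set ns \<subseteq> orders D" "n \<in> orders D"
  shows "arrival D s + c_ho D (dest D s) n - route_times s ns n
    \<le> M * (1 - of_bool (ns \<noteq> [] \<and> n = hd ns))"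
proof (cases "ns \<noteq> [] \<and> n = hd ns")
  case True
  then show ?thesis by (cases ns) (auto simp: route_times_def route_start_def)
next
  case False
  then show ?thesis
    using route_times_nonneg[OF assms(2,3), of s n] K_start[OF assms(1,4)] K_le_M by auto
qed

lemma sub_feasible_of_route:
  assumes s: "s \<in> sat_services D" and ns: "distinct ns" "set ns \<subseteq> orders D" "ns \<noteq> []"
  shows "\<exists>R. sub_feasible D M s (set ns) R \<and> szeta R = route_cost s ns"
proof -
  define R :: "('i, 'n) subroute" where "R = \<lparr>sarc = (\<lambda>n m. of_bool ((n, m) \<in> edges ns)),
    sarc_in = (\<lambda>_ n. of_bool (ns \<noteq> [] \<and> n = hd ns)), sarc_out = (\<lambda>_ n. of_bool (ns \<noteq> [] \<and> n = last ns)),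
    scompl = route_times s ns, scmax = route_length s ns, stard = (\<lambda>n. real (route_late s ns n)),
    szeta = route_cost s ns\<rparr>"
  have "(\<Sum>n\<in>set ns. of_bool (ns \<noteq> [] \<and> n = u)) = (1::real)" if "u \<in> set ns" for u
    using that ns by (simp add: of_bool_def)
  then have ends: "(\<Sum>n\<in>set ns. of_bool (ns \<noteq> [] \<and> n = hd ns)) = (1::real)"
    "(\<Sum>n\<in>set ns. of_bool (ns \<noteq> [] \<and> n = last ns)) = (1::real)"
    using ns by auto
  have flow: "(\<Sum>m\<in>set ns - {n}. of_bool ((n, m) \<in> edges ns)) + of_bool (ns \<noteq> [] \<and> n = last ns) = (1 :: real)"
    "(\<Sum>m\<in>set ns - {n}. of_bool ((m, n) \<in> edges ns)) + of_bool (ns \<noteq> [] \<and> n = hd ns) = (1 :: real)"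
    if "n \<in> set ns" for n
    using sum_edges_out[of ns "set ns" n] sum_edges_in[of ns "set ns" n] ns that by auto
  have len: "route_length s ns = (\<Sum>n\<in>set ns. \<Sum>m\<in>set ns - {n}. c_oo D n m * of_bool ((n, m) \<in> edges ns))
    + (\<Sum>n\<in>set ns. c_ho D (dest D s) n * of_bool (ns \<noteq> [] \<and> n = hd ns))"
    unfolding route_length_def by (rule path_length_eq_sum[symmetric]) (use ns in auto)
  have start: "arrival D s + c_ho D (dest D s) n - route_times s ns n
      \<le> M * (1 - of_bool (ns \<noteq> [] \<and> n = hd ns))" if "n \<in> set ns" for n
    by (rule route_times_start_bigM[OF s ns(1,2)]) (use that ns in blast)
  have arc: "route_times s ns n + c_oo D n m - route_times s ns m \<le> M * (1 - of_bool ((n, m) \<in> edges ns))"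
    if "n \<in> set ns" "m \<in> set ns - {n}" for n m
    by (rule route_times_edge_bigM[OF s ns(1,2)]) (use that ns in blast)+
  have late: "(route_times s ns n - due D n) / 24 \<le> real (route_late s ns n)" for n
    unfolding route_late_def by (rule lateness_ge)
  have "sub_feasible D M s (set ns) R"
    unfolding sub_feasible_def Let_def R_def subroute.simps
    by (intro conjI ballI; ((rule route_length_nonneg[OF s ns(1,2)] route_times_nonneg[OF ns(1,2)]
          of_nat_in_Nats ends flow start arc late len; assumption) | simp add: of_bool_def route_cost_def))
  then show ?thesis by (intro exI[of _ R]) (simp add: R_def)
qed

text \<open>Along a feasible tour the triangle inequality bounds completion times by direct travel, so
  the orders outside \<open>H'\<close> may be skipped without delaying the remaining ones.\<close>

lemma route_of_sub_feasible:
  assumes s: "s \<in> sat_services D" and H: "H \<subseteq> orders D" "H' \<subseteq> H"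
    and R: "sub_feasible D M s H R"
  obtains ns where "distinct ns" "set ns = H'" "route_length s ns \<le> scmax R"
    "\<And>n. n \<in> H' \<Longrightarrow> route_times s ns n \<le> scompl R n"
proof -
  define l where "l = dest D s"
  note R = R[unfolded sub_feasible_def Let_def, folded l_def]
  have fin: "finite H" by (rule finite_subset[OF H(1) finite_sets(1)])
  have pos: "0 < c_oo D n m" if "n \<in> H" "m \<in> H" "n \<noteq> m" for n m
    using c_oo_pos[of n m] that H by blast
  have arc_time: "scompl R n + c_oo D n m - scompl R m \<le> M * (1 - sarc R n m)"
    and sarc: "sarc R n m \<in> {0, 1}" if "n \<in> H" "m \<in> H - {n}" for n m
    using R that by blast+
  have start_time: "arrival D s + c_ho D l n - scompl R n \<le> M * (1 - sarc_in R l n)"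
    and sarc_in: "sarc_in R l n \<in> {0, 1}" and sarc_out: "sarc_out R l n \<in> {0, 1}"
    and compl_nonneg: "0 \<le> scompl R n"
    and flow: "(\<Sum>m\<in>H - {n}. sarc R n m) + sarc_out R l n = 1"
      "(\<Sum>m\<in>H - {n}. sarc R m n) + sarc_in R l n = 1"
    if "n \<in> H" for n
    using R that by blast+
  have C: "scompl R n + c_oo D n m \<le> scompl R m"
    if "n \<in> H" "m \<in> H - {n}" "sarc R n m = 1" for n m
    using arc_time[OF that(1,2)] that(3) by simp
  obtain ns where ns: "distinct ns" "set ns = H" "ns \<noteq> []" "sarc_in R l (hd ns) = 1"
    and arcs: "\<And>n m. (n, m) \<in> edges ns \<Longrightarrow> sarc R n m = 1"
  proof (rule hamiltonian_path[of H "sarc R" "sarc_in R l" "sarc_out R l" "scompl R"])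
    show "scompl R n < scompl R m" if "n \<in> H" "m \<in> H - {n}" "sarc R n m = 1" for n m
      using C[OF that] pos[of n m] that by auto
    show "sum (sarc_in R l) H = 1" using R by blast
  qed (use fin sarc sarc_in sarc_out flow in blast)+
  have tri: "c_oo D n k \<le> c_oo D n m + c_oo D m k"
    if "n \<in> set ns" "m \<in> set ns" "k \<in> set ns" "n \<noteq> m" "m \<noteq> k" "n \<noteq> k" for n m k
    by (rule c_oo_triangle) (use that ns H in auto)
  have sorted: "sorted_wrt (\<lambda>n m. scompl R n + c_oo D n m \<le> scompl R m) ns"
  proof (rule sorted_wrt_of_edges[OF ns(1)])
    show "scompl R n + c_oo D n m \<le> scompl R m" if "(n, m) \<in> edges ns" for n m
      using C[of n m] arcs[OF that] edges_in_set[OF that] edges_neq[OF ns(1) that] ns by auto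
  qed (rule tri)
  \<comment> \<open>After filtering, any order of \<open>H\<close> may come first. Its completion
    time is therefore compared with direct travel from the hub, via the actual first order and the
    triangle inequality at the hub.\<close>
  have start: "route_start s n \<le> scompl R n" if "n \<in> H" for n
  proof -
    have hd: "hd ns \<in> H" using ns by auto
    then have "arrival D s + c_ho D l (hd ns) \<le> scompl R (hd ns)" using start_time[of "hd ns"] ns(4) by simp
    moreover have "c_ho D l n + scompl R (hd ns) \<le> c_ho D l (hd ns) + scompl R n" if "n \<noteq> hd ns"
    proof -
      have "scompl R (hd ns) + c_oo D (hd ns) n \<le> scompl R n"
        using sorted \<open>n \<in> H\<close> that ns by (cases ns) auto
      moreover have "c_ho D l n \<le> c_ho D l (hd ns) + c_oo D (hd ns) n"
        using c_ho_triangle[OF s, of "hd ns" n] hd \<open>n \<in> H\<close> that H by (auto simp: l_def)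
      ultimately show ?thesis by linarith
    qed
    moreover have "0 \<le> scompl R n" using compl_nonneg that .
    ultimately show ?thesis by (cases "n = hd ns") (auto simp: route_start_def l_def[symmetric])
  qed
  let ?ns = "filter (\<lambda>n. n \<in> H') ns"
  have "set ?ns = H'" using ns H by auto
  moreover have "route_length s ?ns \<le> scmax R"
  proof -
    have "route_length s ?ns \<le> route_length s ns"
      unfolding route_length_def
    proof (rule path_length_filter)
      show "c_ho D (dest D s) m \<le> c_ho D (dest D s) n + c_oo D n m"
        if "n \<in> set ns" "m \<in> set ns" "n \<noteq> m" for n m
        by (rule c_ho_triangle[OF s]) (use that ns H in auto)
    qed (use ns H c_ho_nonneg[OF s] tri in \<open>auto intro!: less_imp_le[OF pos]\<close>)
    also have "\<dots> = (\<Sum>n\<in>H. \<Sum>m\<in>H - {n}. c_oo D n m * of_bool ((n, m) \<in> edges ns))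
        + (\<Sum>n\<in>H. c_ho D l n * of_bool (ns \<noteq> [] \<and> n = hd ns))"
      unfolding route_length_def l_def
      by (rule path_length_eq_sum[symmetric]) (use ns fin in auto)
    \<comment> \<open>The arcs of the path are chosen arcs, and costs are nonnegative, so an
      inequality suffices.\<close>
    also have "\<dots> \<le> (\<Sum>n\<in>H. \<Sum>m\<in>H - {n}. c_oo D n m * sarc R n m) + (\<Sum>n\<in>H. c_ho D l n * sarc_in R l n)"
    proof (intro add_mono sum_mono mult_left_mono)
      show "of_bool ((n, m) \<in> edges ns) \<le> sarc R n m" if "n \<in> H" "m \<in> H - {n}" for n m
        using sarc[OF that] arcs[of n m] by auto
      show "of_bool (ns \<noteq> [] \<and> n = hd ns) \<le> sarc_in R l n" if "n \<in> H" for n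
        using sarc_in[OF that] ns(4) by auto
    qed (use c_ho_nonneg[OF s] H in \<open>auto simp: l_def intro!: less_imp_le[OF pos]\<close>)
    also have "\<dots> = scmax R" using R by simp
    finally show ?thesis .
  qed
  moreover have "route_times s ?ns n \<le> scompl R n" if "n \<in> H'" for n
    unfolding route_times_def
    by (rule visit_le) (use sorted start that ns H in \<open>auto intro: sorted_wrt_filter\<close>)
  ultimately show ?thesis using that[of ?ns] ns by auto
qed

lemma sub_feasible_nonempty: "sub_feasible D M s H R \<Longrightarrow> H \<noteq> {}"
  by (auto simp: sub_feasible_def Let_def)

text \<open>\<open>lateness\<close> is the least natural number that a tardiness constraint allows,
  so earlier visits and nonnegative weights can only reduce the cost.\<close>

lemma route_cost_le:
  assumes "finite H" "H \<subseteq> orders D" "set ns = H" "route_length s ns \<le> L"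
    and "\<And>n. n \<in> H \<Longrightarrow> route_times s ns n \<le> C n"
    and "\<And>n. n \<in> H \<Longrightarrow> T n \<in> \<nat> \<and> (C n - due D n) / 24 \<le> T n"
  shows "route_cost s ns \<le> L + (\<Sum>n\<in>H. weight D n * T n)"
  unfolding route_cost_def assms(3)
proof (intro add_mono sum_mono mult_left_mono)
  show "real (route_late s ns n) \<le> T n" if "n \<in> H" for n
    unfolding route_late_def using assms(5,6)[OF that] by (intro lateness_le) auto
qed (use assms weight_nonneg in auto)

text \<open>Times range over a continuum, but for a fixed ordering the best value is its
  \<open>route_cost\<close>, and \<open>H\<close> has only finitely many orderings.\<close>

lemma sub_optimum_exists:
  assumes s: "s \<in> sat_services D" and H: "H \<subseteq> orders D" "H \<noteq> {}"
  obtains R ns where "is_arg_min szeta (sub_feasible D M s H) R" "szeta R = route_cost s ns"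
    "distinct ns" "set ns = H"
proof -
  have fin: "finite H" by (rule finite_subset[OF H(1) finite_sets(1)])
  let ?L = "{ns. distinct ns \<and> set ns = H}"
  have "\<exists>R. is_arg_min szeta (sub_feasible D M s H) R \<and> szeta R \<in> route_cost s ` ?L"
  proof (rule is_arg_min_candidates)
    show "finite (route_cost s ` ?L)"
      by (rule finite_imageI, rule finite_subset[OF _ finite_subset_distinct[OF fin]]) auto
    obtain xs where "set xs = H" "distinct xs" using finite_distinct_list[OF fin] by blast
    then show "\<exists>R. sub_feasible D M s H R"
      using sub_feasible_of_route[OF s, of xs] H by auto
    show "\<exists>R. sub_feasible D M s H R \<and> szeta R = v" if "v \<in> route_cost s ` ?L" for v
      using that sub_feasible_of_route[OF s] H by force
    show "\<exists>v\<in>route_cost s ` ?L. v \<le> szeta R" if R: "sub_feasible D M s H R" for R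
    proof -
      obtain ns where ns: "distinct ns" "set ns = H" "route_length s ns \<le> scmax R"
        "\<And>n. n \<in> H \<Longrightarrow> route_times s ns n \<le> scompl R n"
        by (rule route_of_sub_feasible[OF s H(1) order_refl R]) (rule that)
      have "route_cost s ns \<le> scmax R + (\<Sum>n\<in>H. weight D n * stard R n)"
        by (rule route_cost_le[OF fin H(1) ns(2-4)])
          (use R in \<open>auto simp: sub_feasible_def Let_def\<close>)
      also have "\<dots> \<le> szeta R" using R by (simp add: sub_feasible_def Let_def)
      finally show ?thesis using ns by blast
    qed
  qed
  then obtain R where R: "is_arg_min szeta (sub_feasible D M s H) R" "szeta R \<in> route_cost s ` ?L"
    by (elim exE conjE)
  from R(2) obtain ns where "szeta R = route_cost s ns" "ns \<in> ?L" by (rule imageE)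
  then show ?thesis using R(1) by (intro that[of R ns]) simp_all
qed

section \<open>Plans\<close>

lemma feasible_binary:
  assumes "intermodal_feasible D X"
  shows "g \<in> comps D \<Longrightarrow> s \<in> services D \<Longrightarrow> xv X g s \<in> {0, 1}"
    and "n \<in> orders D \<Longrightarrow> g \<in> comps D \<Longrightarrow> yv X n g \<in> {0, 1}"
    and "s \<in> services D \<Longrightarrow> vv X s \<in> {0, 1}"
    and "n \<in> orders D \<Longrightarrow> s \<in> sat_services D \<Longrightarrow> hv X n s \<in> {0, 1}"
    and "g \<in> comps D \<Longrightarrow> ev X g \<in> {0, 1}"
proof -
  have "plan_domains D X" using assms unfolding intermodal_feasible_def by blast
  then show "g \<in> comps D \<Longrightarrow> s \<in> services D \<Longrightarrow> xv X g s \<in> {0, 1}"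
    "n \<in> orders D \<Longrightarrow> g \<in> comps D \<Longrightarrow> yv X n g \<in> {0, 1}"
    "s \<in> services D \<Longrightarrow> vv X s \<in> {0, 1}"
    "n \<in> orders D \<Longrightarrow> s \<in> sat_services D \<Longrightarrow> hv X n s \<in> {0, 1}"
    "g \<in> comps D \<Longrightarrow> ev X g \<in> {0, 1}"
    unfolding plan_domains_def by simp_all
qed

lemma feasible_vv: "intermodal_feasible D X \<Longrightarrow> g \<in> comps D \<Longrightarrow> s \<in> services D \<Longrightarrow> xv X g s \<le> vv X s"
  unfolding intermodal_feasible_def by blast

lemma feasible_hv:
  "intermodal_feasible D X \<Longrightarrow> n \<in> orders D \<Longrightarrow> g \<in> comps D \<Longrightarrow> s \<in> sat_services D \<Longrightarrow>
    xv X g s + yv X n g \<le> hv X n s + 1"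
  unfolding intermodal_feasible_def by blast

lemma feasible_Vv: "intermodal_feasible D X \<Longrightarrow> s \<in> services D \<Longrightarrow> Vv X s = (\<Sum>g\<in>comps D. xv X g s)"
  unfolding intermodal_feasible_def by blast

lemma sum_sat_services:
  "(\<Sum>l\<in>sat_hubs D. \<Sum>s\<in>in_services D l. f s) = (\<Sum>s\<in>sat_services D. f s)"
proof -
  have "(\<Sum>l\<in>sat_hubs D. \<Sum>s\<in>in_services D l. f s)
      = (\<Sum>l\<in>sat_hubs D. sum f {s \<in> sat_services D. dest D s = l})"
    by (intro sum.cong) (auto simp: sat_services_def in_services_def)
  also have "\<dots> = sum f (sat_services D)" by (rule sum.group) (auto simp: sat_hub)
  finally show ?thesis .
qed

lemma feasible_sat_sum:
  assumes "intermodal_feasible D X" "g \<in> comps D"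
  shows "(\<Sum>s\<in>sat_services D. xv X g s) = ev X g"
proof -
  have "\<forall>g\<in>comps D. (\<Sum>l\<in>sat_hubs D. \<Sum>s\<in>in_services D l. xv X g s) = ev X g"
    using assms(1) unfolding intermodal_feasible_def by blast
  then show ?thesis using assms(2) by (simp add: sum_sat_services)
qed

lemma feasible_ev:
  "intermodal_feasible D X \<Longrightarrow> g \<in> comps D \<Longrightarrow> n \<in> orders D \<Longrightarrow> yv X n g \<le> ev X g"
  unfolding intermodal_feasible_def by blast

text \<open>The physical delivery, read off from compartments and flows. It is the part of
  \<open>hv\<close> that the constraints force to be 1.\<close>

definition carries :: "('n, 'g, 's) plan \<Rightarrow> 'n \<Rightarrow> 's \<Rightarrow> bool" where
  "carries X n s \<longleftrightarrow> (\<exists>g\<in>comps D. yv X n g = 1 \<and> xv X g s = 1)"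

text \<open>The compartment holding the order is in use, and the flow of a used compartment must
  enter some satellite hub.\<close>

lemma carries_exists:
  assumes X: "intermodal_feasible D X" and n: "n \<in> orders D"
  obtains s where "s \<in> sat_services D" "carries X n s"
proof -
  have "(\<Sum>g\<in>comps D. yv X n g) = 1" using X n unfolding intermodal_feasible_def by blast
  then obtain g where g: "g \<in> comps D" "yv X n g = 1"
    using binary_sum_witness[of "comps D" "yv X n"] feasible_binary(2)[OF X n] by auto
  then have "ev X g \<noteq> 0" using feasible_ev[OF X g(1) n] by auto
  then obtain s where "s \<in> sat_services D" "xv X g s = 1"
    using binary_sum_witness[of "sat_services D" "xv X g"] feasible_binary(1)[OF X g(1)]
      feasible_sat_sum[OF X g(1)] sat_service by auto
  then show ?thesis using that g by (auto simp: carries_def)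
qed

lemma carries_unique:
  assumes X: "intermodal_feasible D X" and n: "n \<in> orders D"
    and s: "s \<in> sat_services D" "carries X n s" and t: "t \<in> sat_services D" "carries X n t"
  shows "s = t"
proof -
  obtain g h where g: "g \<in> comps D" "yv X n g = 1" "xv X g s = 1"
    and h: "h \<in> comps D" "yv X n h = 1" "xv X h t = 1"
    using s t by (auto simp: carries_def)
  have "(\<Sum>g\<in>comps D. yv X n g) = 1" using X n unfolding intermodal_feasible_def by blast
  then have "g = h"
    using binary_sum_unique[of "comps D" "yv X n" g h] feasible_binary(2)[OF X n] g h by auto
  moreover have "sum (xv X g) (sat_services D) \<le> 1"
    using feasible_sat_sum[OF X g(1)] feasible_binary(5)[OF X g(1)] by auto
  ultimately show ?thesis
    using binary_sum_unique[of "sat_services D" "xv X g" s t] feasible_binary(1)[OF X g(1)]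
      sat_service s(1) t(1) g h by auto
qed

lemma carries_active:
  assumes X: "intermodal_feasible D X" and "n \<in> orders D" "s \<in> sat_services D" "carries X n s"
  shows "hv X n s = 1" "vv X s = 1"
proof -
  obtain g where g: "g \<in> comps D" "yv X n g = 1" "xv X g s = 1"
    using assms(4) by (auto simp: carries_def)
  show "hv X n s = 1"
    using feasible_hv[OF X assms(2) g(1) assms(3)] feasible_binary(4)[OF X assms(2,3)] g by auto
  show "vv X s = 1"
    using feasible_vv[OF X g(1) sat_service[OF assms(3)]] feasible_binary(3)[OF X sat_service[OF assms(3)]] g
    by auto
qed

text \<open>Apart from its binary domain, \<open>hv\<close> occurs only in the linking constraint,
  as an upper bound for \<open>xv\<close> and \<open>yv\<close>. Any binary choice that respects
  actual deliveries is thus feasible; both \<open>drop_unused\<close> and the reduction to carriers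
  are such choices.\<close>

lemma intermodal_feasible_hv_update:
  assumes X: "intermodal_feasible D X"
    and "\<And>n s. n \<in> orders D \<Longrightarrow> s \<in> sat_services D \<Longrightarrow> h n s \<in> {0, 1}"
    and h: "\<And>n s. n \<in> orders D \<Longrightarrow> s \<in> sat_services D \<Longrightarrow> carries X n s \<Longrightarrow> h n s = 1"
  shows "intermodal_feasible D (X\<lparr>hv := h\<rparr>)"
proof -
  have "xv X g s + yv X n g \<le> h n s + 1"
    if dom: "n \<in> orders D" "g \<in> comps D" "s \<in> sat_services D" for n g s
  proof -
    have "h n s = 1" if "xv X g s = 1" "yv X n g = 1"
      using that dom by (intro h) (auto simp: carries_def)
    then show ?thesis
      using feasible_binary(1)[OF X dom(2) sat_service[OF dom(3)]] feasible_binary(2)[OF X dom(1,2)]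
        assms(2)[OF dom(1,3)]
      by auto
  qed
  moreover have "plan_domains D X" using X by (simp add: intermodal_feasible_def)
  then have "plan_domains D (X\<lparr>hv := h\<rparr>)" using assms(2) by (simp add: plan_domains_def)
  ultimately show ?thesis using X by (simp add: intermodal_feasible_def)
qed

lemma transport_cost_hv_update [simp]: "transport_cost D (X\<lparr>hv := h\<rparr>) = transport_cost D X"
  by (simp add: transport_cost_def)

lemma drop_unused_feasible:
  assumes X: "intermodal_feasible D X"
  shows "intermodal_feasible D (drop_unused X)"
  unfolding drop_unused_def
  by (rule intermodal_feasible_hv_update[OF X])
    (use feasible_binary(3,4)[OF X] sat_service carries_active[OF X] in \<open>fastforce+\<close>)

section \<open>Between routings of the full problem and routes of the subproblems\<close>

lemma sub_feasible_of_routing: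
  assumes X: "intermodal_feasible D X" and R: "routing_feasible D M X R"
    and s: "s \<in> sat_services D" "vv X s = 1"
  shows "\<exists>R'. sub_feasible D M s (assigned D X s) R' \<and> scmax R' = cmax R s
    \<and> scompl R' = compl R s \<and> stard R' = tard R"
proof -
  define H where "H = assigned D X s"
  define l where "l = dest D s"
  have H: "H \<subseteq> orders D" "\<And>n. n \<in> H \<Longrightarrow> hv X n s = 1"
    and notH: "\<And>n. n \<in> orders D - H \<Longrightarrow> hv X n s = 0"
    using feasible_binary(4)[OF X _ s(1)] by (auto simp: H_def assigned_def)
  note rf = R[unfolded routing_feasible_def ball_sat_services, THEN conjunct2, THEN bspec, OF s(1), folded l_def]
  have arc: "arc R s n m \<in> {0, 1}" "arc R s n m \<le> hv X n s" "arc R s n m \<le> hv X m s"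
      "compl R s n + c_oo D n m - compl R s m \<le> M * (1 - arc R s n m)"
    if "n \<in> orders D" "m \<in> orders D - {n}" for n m
    using rf that by blast+
  have node: "compl R s n \<ge> 0" "arc_in R s l n \<in> {0, 1}" "arc_out R s l n \<in> {0, 1}"
      "arc_in R s l n \<le> hv X n s" "arc_out R s l n \<le> hv X n s"
      "(\<Sum>m\<in>orders D - {n}. arc R s n m) + arc_out R s l n = hv X n s"
      "(\<Sum>m\<in>orders D - {n}. arc R s m n) + arc_in R s l n = hv X n s"
      "arrival D s * hv X n s + c_ho D l n - compl R s n \<le> M * (1 - arc_in R s l n)"
      "tard R n \<ge> (compl R s n - due D n) / 24"
    if "n \<in> orders D" for n
    using rf that by blast+
  have tard: "tard R n \<in> \<nat>" if "n \<in> orders D" for n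
    using R that unfolding routing_feasible_def by blast
  have total: "(\<Sum>n\<in>orders D. arc_in R s l n) = 1" "(\<Sum>n\<in>orders D. arc_out R s l n) = 1"
    "cmax R s \<ge> 0"
    "cmax R s = (\<Sum>n\<in>orders D. \<Sum>m\<in>orders D - {n}. c_oo D n m * arc R s n m)
        + (\<Sum>n\<in>orders D. c_ho D l n * arc_in R s l n)"
    using rf unfolding s(2) by blast+
  \<comment> \<open>Arc and end variables are bounded by \<open>hv\<close>, so nothing flows through
    orders outside \<open>H\<close> and all sums may be restricted to \<open>H\<close>.\<close>
  have arc0: "arc R s n m = 0" if "n \<in> orders D" "m \<in> orders D - {n}" "n \<notin> H \<or> m \<notin> H" for n m
    using arc[OF that(1,2)] notH[of n] notH[of m] that by auto
  have end0: "arc_in R s l n = 0" "arc_out R s l n = 0" if "n \<in> orders D - H" for n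
    using node(2-5)[of n] notH[of n] that by auto
  have shrink: "sum f H = sum f (orders D)" if "\<And>n. n \<in> orders D - H \<Longrightarrow> f n = 0" for f :: "'n \<Rightarrow> real"
    by (rule sum.mono_neutral_left) (use that H in auto)
  have shrink': "sum f (H - {n}) = sum f (orders D - {n})"
    if "\<And>m. m \<in> orders D - {n} \<Longrightarrow> m \<notin> H \<Longrightarrow> f m = 0" for f :: "'n \<Rightarrow> real" and n
    by (rule sum.mono_neutral_left) (use that H in auto)
  have flow: "(\<Sum>m\<in>H - {n}. arc R s n m) + arc_out R s l n = 1"
      "(\<Sum>m\<in>H - {n}. arc R s m n) + arc_in R s l n = 1" if n: "n \<in> H" for n
  proof -
    have no: "n \<in> orders D" using n H by auto
    have "(\<Sum>m\<in>H - {n}. arc R s n m) = (\<Sum>m\<in>orders D - {n}. arc R s n m)"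
      by (rule shrink') (use arc0 no in auto)
    then show "(\<Sum>m\<in>H - {n}. arc R s n m) + arc_out R s l n = 1"
      using node(6)[OF no] H(2)[OF n] by simp
    have "(\<Sum>m\<in>H - {n}. arc R s m n) = (\<Sum>m\<in>orders D - {n}. arc R s m n)"
      by (rule shrink') (use arc0 no in auto)
    then show "(\<Sum>m\<in>H - {n}. arc R s m n) + arc_in R s l n = 1"
      using node(7)[OF no] H(2)[OF n] by simp
  qed
  have ends: "(\<Sum>n\<in>H. arc_in R s l n) = 1" "(\<Sum>n\<in>H. arc_out R s l n) = 1"
    using shrink[of "arc_in R s l"] shrink[of "arc_out R s l"] end0 total by simp_all
  have "(\<Sum>n\<in>H. \<Sum>m\<in>H - {n}. c_oo D n m * arc R s n m)
      = (\<Sum>n\<in>H. \<Sum>m\<in>orders D - {n}. c_oo D n m * arc R s n m)"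
    by (intro sum.cong[OF refl] shrink') (use arc0 H in auto)
  also have "\<dots> = (\<Sum>n\<in>orders D. \<Sum>m\<in>orders D - {n}. c_oo D n m * arc R s n m)"
    by (rule shrink) (use arc0 in \<open>auto intro!: sum.neutral\<close>)
  finally have len: "cmax R s = (\<Sum>n\<in>H. \<Sum>m\<in>H - {n}. c_oo D n m * arc R s n m)
      + (\<Sum>n\<in>H. c_ho D l n * arc_in R s l n)"
    using total(4) shrink[of "\<lambda>n. c_ho D l n * arc_in R s l n"] end0 by simp
  have start: "arrival D s + c_ho D l n - compl R s n \<le> M * (1 - arc_in R s l n)" if "n \<in> H" for n
    using node(8)[of n] H(2)[OF that] H(1) that by auto
  define R' :: "('i, 'n) subroute" where "R' = \<lparr>sarc = arc R s, sarc_in = arc_in R s,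
    sarc_out = arc_out R s, scompl = compl R s, scmax = cmax R s, stard = tard R,
    szeta = cmax R s + (\<Sum>n\<in>H. weight D n * tard R n)\<rparr>"
  have inH: "n \<in> orders D" if "n \<in> H" for n using that H by blast
  have inH': "m \<in> orders D - {n}" if "m \<in> H - {n}" for n m using that H by blast
  have "sub_feasible D M s H R'"
    unfolding sub_feasible_def Let_def R'_def subroute.simps l_def[symmetric]
    by (intro conjI ballI; (rule total(3) node(1-3,9)[OF inH] tard[OF inH] arc(1,4)[OF inH inH']
      ends flow start len order_refl; assumption))
  then show ?thesis by (intro exI[of _ R']) (simp add: R'_def H_def)
qed

text \<open>\<open>tard\<close> adds the delays of all visits of an order instead of taking their
  maximum. The objective then splits exactly into route costs.\<close>

definition routing_of_routes :: "('s \<Rightarrow> 'n list) \<Rightarrow> ('i, 'n, 's) routing" where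
  "routing_of_routes L = \<lparr>arc = (\<lambda>s n m. of_bool ((n, m) \<in> edges (L s))),
    arc_in = (\<lambda>s _ n. of_bool (L s \<noteq> [] \<and> n = hd (L s))),
    arc_out = (\<lambda>s _ n. of_bool (L s \<noteq> [] \<and> n = last (L s))),
    compl = (\<lambda>s. route_times s (L s)), cmax = (\<lambda>s. route_length s (L s)),
    tard = (\<lambda>n. real (\<Sum>s\<in>{s \<in> sat_services D. n \<in> set (L s)}. route_late s (L s) n))\<rparr>"

lemma routing_of_routes_feasible:
  assumes X: "intermodal_feasible D X"
    and L: "\<And>s. s \<in> sat_services D \<Longrightarrow> distinct (L s)"
      "\<And>s. s \<in> sat_services D \<Longrightarrow> set (L s) = {n \<in> orders D. hv X n s = 1}"
      "\<And>s. s \<in> sat_services D \<Longrightarrow> L s \<noteq> [] \<longleftrightarrow> vv X s = 1"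
  shows "routing_feasible D M X (routing_of_routes L)"
proof -
  have sub: "set (L s) \<subseteq> orders D" if "s \<in> sat_services D" for s
    using L(2)[OF that] by auto
  have hv: "hv X n s = of_bool (n \<in> set (L s))" if "n \<in> orders D" "s \<in> sat_services D" for n s
    using feasible_binary(4)[OF X that] L(2)[OF that(2)] that by auto
  have vv: "vv X s = of_bool (L s \<noteq> [])" if "s \<in> sat_services D" for s
    using feasible_binary(3)[OF X sat_service[OF that]] L(3)[OF that] by auto
  have late: "real (route_late s (L s) n)
      \<le> real (\<Sum>s\<in>{s \<in> sat_services D. n \<in> set (L s)}. route_late s (L s) n)"
    if "s \<in> sat_services D" "n \<in> set (L s)" for s n
    unfolding of_nat_le_iff by (rule member_le_sum) (use that in auto)
  have tard: "(route_times s (L s) n - due D n) / 24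
      \<le> real (\<Sum>s\<in>{s \<in> sat_services D. n \<in> set (L s)}. route_late s (L s) n)"
    if s: "s \<in> sat_services D" and n: "n \<in> orders D" for s n
  proof -
    \<comment> \<open>The tardiness constraint also concerns services that do not visit
      \<open>n\<close>. Their time 0 may still exceed a negative due date, so it is compared with
      the nonnegative time on a service \<open>t\<close> that does visit \<open>n\<close>.\<close>
    obtain t where t: "t \<in> sat_services D" "n \<in> set (L t)"
      using carries_exists[OF X n] carries_active(1)[OF X n] L(2) n by (metis (mono_tags, lifting) mem_Collect_eq)
    have "\<exists>u\<in>sat_services D. n \<in> set (L u) \<and> route_times s (L s) n \<le> route_times u (L u) n"
    proof (cases "n \<in> set (L s)")
      case False
      then have "route_times s (L s) n = 0" by (simp add: route_times_def visit_outside)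
      then show ?thesis using t route_times_nonneg[OF L(1)[OF t(1)] sub[OF t(1)]] by auto
    qed (use s in auto)
    then obtain u where u: "u \<in> sat_services D" "n \<in> set (L u)"
      "route_times s (L s) n \<le> route_times u (L u) n" by blast
    have "(route_times s (L s) n - due D n) / 24 \<le> (route_times u (L u) n - due D n) / 24"
      using u(3) by simp
    also have "\<dots> \<le> real (route_late u (L u) n)" unfolding route_late_def by (rule lateness_ge)
    finally show ?thesis using late[OF u(1,2)] by linarith
  qed
  have ends: "(\<Sum>n\<in>orders D. of_bool (L s \<noteq> [] \<and> n = hd (L s))) = vv X s"
    "(\<Sum>n\<in>orders D. of_bool (L s \<noteq> [] \<and> n = last (L s))) = vv X s"
    if s: "s \<in> sat_services D" for s
  proof -
    have "hd (L s) \<in> orders D \<and> last (L s) \<in> orders D" if "L s \<noteq> []"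
      using that sub[OF s] by auto
    then show "(\<Sum>n\<in>orders D. of_bool (L s \<noteq> [] \<and> n = hd (L s))) = vv X s"
      "(\<Sum>n\<in>orders D. of_bool (L s \<noteq> [] \<and> n = last (L s))) = vv X s"
      unfolding vv[OF s] by (cases "L s = []"; simp add: of_bool_def)+
  qed
  have edge_le: "of_bool ((n, m) \<in> edges (L s)) \<le> hv X n s" "of_bool ((n, m) \<in> edges (L s)) \<le> hv X m s"
    if "s \<in> sat_services D" "n \<in> orders D" "m \<in> orders D" for s n m
    using hv that edges_in_set[of n m "L s"] by auto
  have end_le: "of_bool (L s \<noteq> [] \<and> n = hd (L s)) \<le> hv X n s"
    "of_bool (L s \<noteq> [] \<and> n = last (L s)) \<le> hv X n s"
    if "s \<in> sat_services D" "n \<in> orders D" for s n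
    using hv[OF that(2,1)] by auto
  have start: "arrival D s * hv X n s + c_ho D (dest D s) n - route_times s (L s) n
      \<le> M * (1 - of_bool (L s \<noteq> [] \<and> n = hd (L s)))"
    if s: "s \<in> sat_services D" and n: "n \<in> orders D" for s n
  proof (cases "n \<in> set (L s)")
    case True
    then show ?thesis
      using route_times_start_bigM[OF s L(1)[OF s] sub[OF s] n] hv[OF n s] by simp
  next
    \<comment> \<open>Off the route \<open>hv\<close> and the entry indicator are both 0, and
      \<open>M\<close> has to absorb the remaining \<open>c_ho\<close>.\<close>
    case False
    then have "\<not> (L s \<noteq> [] \<and> n = hd (L s))" by auto
    then show ?thesis
      using False hv[OF n s] K_start[OF s n] K_le_M route_times_nonneg[OF L(1)[OF s] sub[OF s], of s n]
      by auto
  qed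
  have len: "route_length s (L s) = (\<Sum>n\<in>orders D. \<Sum>m\<in>orders D - {n}. c_oo D n m * of_bool ((n, m) \<in> edges (L s)))
      + (\<Sum>n\<in>orders D. c_ho D (dest D s) n * of_bool (L s \<noteq> [] \<and> n = hd (L s)))"
    if "s \<in> sat_services D" for s
    unfolding route_length_def by (rule path_length_eq_sum[symmetric]) (use L(1) sub that in auto)
  have flow: "(\<Sum>m\<in>orders D - {n}. of_bool ((n, m) \<in> edges (L s))) + of_bool (L s \<noteq> [] \<and> n = last (L s)) = hv X n s"
    "(\<Sum>m\<in>orders D - {n}. of_bool ((m, n) \<in> edges (L s))) + of_bool (L s \<noteq> [] \<and> n = hd (L s)) = hv X n s"
    if "s \<in> sat_services D" "n \<in> orders D" for s n
    using sum_edges_out[OF L(1)[OF that(1)] sub[OF that(1)] _ that(2)]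
      sum_edges_in[OF L(1)[OF that(1)] sub[OF that(1)] _ that(2)] hv[OF that(2,1)] by auto
  have len_nonneg: "0 \<le> route_length s (L s)" if "s \<in> sat_services D" for s
    by (rule route_length_nonneg[OF that L(1)[OF that] sub[OF that]])
  have times_nonneg: "0 \<le> route_times s (L s) n" if "s \<in> sat_services D" for s n
    by (rule route_times_nonneg[OF L(1)[OF that] sub[OF that]])
  have arc_time: "route_times s (L s) n + c_oo D n m - route_times s (L s) m
      \<le> M * (1 - of_bool ((n, m) \<in> edges (L s)))"
    if "s \<in> sat_services D" "n \<in> orders D" "m \<in> orders D" for s n m
    by (rule route_times_edge_bigM[OF that(1) L(1)[OF that(1)] sub[OF that(1)] that(2,3)])
  have bin: "of_bool b \<in> {0, 1 :: real}" for b by simp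
  show ?thesis
    unfolding routing_feasible_def ball_sat_services routing_of_routes_def routing.simps
    by (intro conjI ballI; (rule of_nat_in_Nats bin tard ends edge_le[OF _ _ DiffD1] end_le start len flow len_nonneg
          times_nonneg arc_time[OF _ _ DiffD1]; assumption))
qed

lemma P_objective_routing_of_routes:
  assumes "\<And>s. s \<in> sat_services D \<Longrightarrow> set (L s) \<subseteq> orders D"
  shows "P_objective D (X, routing_of_routes L)
    = transport_cost D X + (\<Sum>s\<in>sat_services D. route_cost s (L s))"
proof -
  have "(\<Sum>n\<in>orders D. weight D n * real (\<Sum>s\<in>{s \<in> sat_services D. n \<in> set (L s)}. route_late s (L s) n))
      = (\<Sum>n\<in>orders D. \<Sum>s\<in>{s \<in> sat_services D. n \<in> set (L s)}. weight D n * real (route_late s (L s) n))"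
    by (simp add: sum_distrib_left)
  also have "\<dots> = (\<Sum>s\<in>sat_services D. \<Sum>n\<in>{n \<in> orders D. n \<in> set (L s)}. weight D n * real (route_late s (L s) n))"
    by (rule sum.swap_restrict) auto
  also have "\<dots> = (\<Sum>s\<in>sat_services D. \<Sum>n\<in>set (L s). weight D n * real (route_late s (L s) n))"
    using assms by (intro sum.cong) auto
  finally show ?thesis
    by (simp add: P_objective_def routing_of_routes_def route_cost_def sum.distrib)
qed

section \<open>The master problem\<close>

text \<open>The least tardiness that the relaxation constraints admit; \<open>insert 0\<close>
  covers networks without services into satellite hubs.\<close>

definition master_tard :: "('n, 'g, 's) plan \<Rightarrow> 'n \<Rightarrow> nat" where
  "master_tard X n = Max (insert 0 ((\<lambda>s. nat \<lceil>(arrival D s + c_ho D (dest D s) n - due D n) / 24 * hv X n s\<rceil>)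
    ` sat_services D))"

definition relaxed_cost :: "('n, 'g, 's) plan \<Rightarrow> real" where
  "relaxed_cost X = transport_cost D X + (\<Sum>n\<in>orders D. weight D n * real (master_tard X n))
    + (\<Sum>s\<in>sat_services D. \<Sum>n\<in>orders D. c_min D n * hv X n s)"

definition cut_term :: "('n, 'g, 's) cut \<Rightarrow> ('n, 'g, 's) plan \<Rightarrow> 's \<Rightarrow> real" where
  "cut_term c X s = max 0 (snd c s
    - snd c s * (real (card (assigned D (fst c) s)) - (\<Sum>n\<in>assigned D (fst c) s. hv X n s)))"

definition cut_cost :: "('n, 'g, 's) plan \<Rightarrow> ('n, 'g, 's) cut \<Rightarrow> real" where
  "cut_cost X c = (\<Sum>s\<in>active D (fst c). cut_term c X s) + transport_cost D X"

text \<open>The least master objective for a fixed plan, obtained by giving every auxiliary variable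
  its smallest admissible value.\<close>

definition master_value :: "('n, 'g, 's) cut list \<Rightarrow> ('n, 'g, 's) plan \<Rightarrow> real" where
  "master_value cuts X = Max (insert (transport_cost D X) (insert (relaxed_cost X) (cut_cost X ` set cuts)))"

lemma cut_satisfied_iff:
  "cut_satisfied D c X z zr \<longleftrightarrow> (\<forall>s\<in>active D (fst c). cut_term c X s \<le> zr s)
    \<and> (\<Sum>s\<in>active D (fst c). zr s) + transport_cost D X \<le> z"
  by (auto simp: cut_satisfied_def cut_term_def split: prod.splits)

lemma master_value_le:
  assumes m: "master_feasible D cuts m"
  shows "master_value cuts (mplan m) \<le> mz m"
proof -
  note f = m[unfolded master_feasible_def Let_def ball_sat_services]
  have tard: "(arrival D s + c_ho D (dest D s) n - due D n) / 24 * hv (mplan m) n s \<le> mtstar m n"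
    if "n \<in> orders D" "s \<in> sat_services D" for n s
    using f that by blast
  have "real (master_tard (mplan m) n) \<le> mtstar m n" if n: "n \<in> orders D" for n
  proof -
    have "mtstar m n \<in> \<nat>" using f n by blast
    then obtain k where k: "mtstar m n = real k" by (rule Nats_cases)
    have "(arrival D s + c_ho D (dest D s) n - due D n) / 24 * hv (mplan m) n s \<le> real k"
      if "s \<in> sat_services D" for s
      using tard[OF n that] by (simp only: k)
    then have "master_tard (mplan m) n \<le> k"
      unfolding master_tard_def by (subst Max_le_iff) (auto simp: nat_le_iff ceiling_le_iff)
    then show ?thesis using k by simp
  qed
  then have "(\<Sum>n\<in>orders D. weight D n * real (master_tard (mplan m) n)) \<le> (\<Sum>n\<in>orders D. weight D n * mtstar m n)"
    by (intro sum_mono mult_left_mono weight_nonneg)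
  moreover have "(\<Sum>s\<in>sat_services D. \<Sum>n\<in>orders D. c_min D n * hv (mplan m) n s) \<le> sum (mcstar m) (sat_services D)"
    using f by (intro sum_mono) blast
  ultimately have "relaxed_cost (mplan m) \<le> mz m" using f by (simp add: relaxed_cost_def)
  moreover have "cut_cost (mplan m) c \<le> mz m" if c: "c \<in> set cuts" for c
  proof -
    obtain k where k: "k < length cuts" "c = cuts ! k" using c by (auto simp: in_set_conv_nth)
    then have "cut_satisfied D c (mplan m) (mz m) (mzr m k)" using f by blast
    then show ?thesis
      unfolding cut_satisfied_iff cut_cost_def
      using sum_mono[of "active D (fst c)" "cut_term c (mplan m)" "mzr m k"] by auto
  qed
  ultimately show ?thesis using f by (auto simp: master_value_def)
qed

lemma master_value_attained:
  assumes X: "intermodal_feasible D X"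
  shows "\<exists>m. master_feasible D cuts m \<and> mz m = master_value cuts X \<and> mplan m = X"
proof -
  define m where "m = \<lparr>mplan = X, mz = master_value cuts X,
    mcstar = (\<lambda>s. \<Sum>n\<in>orders D. c_min D n * hv X n s), mtstar = (\<lambda>n. real (master_tard X n)),
    mzr = (\<lambda>k. cut_term (cuts ! k) X)\<rparr>"
  have le: "transport_cost D X \<le> master_value cuts X" "relaxed_cost X \<le> master_value cuts X"
    "\<And>k. k < length cuts \<Longrightarrow> cut_cost X (cuts ! k) \<le> master_value cuts X"
    unfolding master_value_def by (intro Max_ge; force)+
  have tard: "(arrival D s + c_ho D (dest D s) n - due D n) / 24 * hv X n s \<le> real (master_tard X n)"
    if "s \<in> sat_services D" for s n
  proof -
    let ?t = "(arrival D s + c_ho D (dest D s) n - due D n) / 24 * hv X n s"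
    have "nat \<lceil>?t\<rceil> \<le> master_tard X n"
      unfolding master_tard_def by (rule Max_ge) (use that in auto)
    then show ?thesis by linarith
  qed
  have "master_feasible D cuts m"
    unfolding master_feasible_def Let_def ball_sat_services cut_satisfied_iff m_def master.simps
    using X le tard by (auto simp: relaxed_cost_def cut_cost_def)
  then show ?thesis by (intro exI[of _ m]) (simp add: m_def)
qed

section \<open>Finiteness of the master problem up to signatures\<close>

definition plan_sig :: "('n, 'g, 's) plan \<Rightarrow> ('g \<times> 's) set \<times> 's set \<times> ('n \<times> 's) set" where
  "plan_sig X = ({(g, s) \<in> comps D \<times> services D. xv X g s = 1}, {s \<in> services D. vv X s = 1},
    {(n, s) \<in> orders D \<times> sat_services D. hv X n s = 1})"

lemma finite_plan_sigs: "finite (range plan_sig)"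
proof (rule finite_subset)
  show "range plan_sig \<subseteq> Pow (comps D \<times> services D) \<times> Pow (services D) \<times> Pow (orders D \<times> sat_services D)"
    by (auto simp: plan_sig_def)
qed auto

lemma plan_sig_active: "plan_sig X = plan_sig Y \<Longrightarrow> active D X = active D Y"
  by (auto simp: plan_sig_def active_def set_eq_iff dest: sat_service)

lemma plan_sig_assigned:
  assumes "plan_sig X = plan_sig Y" "s \<in> sat_services D"
  shows "assigned D X s = assigned D Y s"
  using assms by (auto simp: plan_sig_def assigned_def set_eq_iff)

text \<open>Feasible entries are binary, so the positions of the ones determine \<open>xv\<close>,
  \<open>vv\<close> and \<open>hv\<close> on the index sets. \<open>Vv\<close> is a sum of
  \<open>xv\<close>, and the master value is computed from these four.\<close>

lemma plan_sig_master_value: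
  assumes X: "intermodal_feasible D X" and Y: "intermodal_feasible D Y" and sig: "plan_sig X = plan_sig Y"
  shows "master_value cuts X = master_value cuts Y"
proof -
  have x: "xv X g s = xv Y g s" if "g \<in> comps D" "s \<in> services D" for g s
  proof -
    have "xv X g s = 1 \<longleftrightarrow> xv Y g s = 1" using sig that by (auto simp: plan_sig_def set_eq_iff)
    then show ?thesis using feasible_binary(1)[OF X that] feasible_binary(1)[OF Y that] by auto
  qed
  have v: "vv X s = vv Y s" if "s \<in> services D" for s
  proof -
    have "vv X s = 1 \<longleftrightarrow> vv Y s = 1" using sig that by (auto simp: plan_sig_def set_eq_iff)
    then show ?thesis using feasible_binary(3)[OF X that] feasible_binary(3)[OF Y that] by auto
  qed
  have h: "hv X n s = hv Y n s" if "n \<in> orders D" "s \<in> sat_services D" for n s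
  proof -
    have "hv X n s = 1 \<longleftrightarrow> hv Y n s = 1" using sig that by (auto simp: plan_sig_def set_eq_iff)
    then show ?thesis using feasible_binary(4)[OF X that] feasible_binary(4)[OF Y that] by auto
  qed
  have f: "transport_cost D X = transport_cost D Y"
    unfolding transport_cost_def
    by (intro sum.cong refl arg_cong2[where f = "(+)"] arg_cong2[where f = "(*)"] v)
      (auto simp: feasible_Vv[OF X] feasible_Vv[OF Y] x)
  have t: "master_tard X n = master_tard Y n" if "n \<in> orders D" for n
  proof -
    have "(\<lambda>s. nat \<lceil>(arrival D s + c_ho D (dest D s) n - due D n) / 24 * hv X n s\<rceil>) ` sat_services D
      = (\<lambda>s. nat \<lceil>(arrival D s + c_ho D (dest D s) n - due D n) / 24 * hv Y n s\<rceil>) ` sat_services D"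
      using h that by (intro image_cong) auto
    then show ?thesis by (simp only: master_tard_def)
  qed
  have r: "relaxed_cost X = relaxed_cost Y"
    unfolding relaxed_cost_def f using t h by simp
  have "cut_term c X s = cut_term c Y s" if "s \<in> active D (fst c)" for c s
  proof -
    have "(\<Sum>n\<in>assigned D (fst c) s. hv X n s) = (\<Sum>n\<in>assigned D (fst c) s. hv Y n s)"
      using that by (intro sum.cong) (auto simp: assigned_def active_def h)
    then show ?thesis by (simp add: cut_term_def)
  qed
  then have "cut_cost X c = cut_cost Y c" for c by (simp add: cut_cost_def f)
  then show ?thesis by (simp add: master_value_def f r cong: image_cong)
qed

lemma master_optimal_exists:
  assumes "intermodal_feasible D X"
  shows "\<exists>m. master_optimal D cuts m"
proof -
  let ?V = "master_value cuts ` {X. intermodal_feasible D X}"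
  have "\<exists>m. is_arg_min mz (master_feasible D cuts) m \<and> mz m \<in> ?V"
  proof (rule is_arg_min_candidates)
    have "finite (plan_sig ` {X. intermodal_feasible D X})"
      using finite_plan_sigs by (rule rev_finite_subset) auto
    then show "finite ?V"
      by (rule finite_image_factor) (auto intro: plan_sig_master_value)
    show "\<exists>m. master_feasible D cuts m" using master_value_attained[OF assms] by blast
    show "\<exists>v\<in>?V. v \<le> mz m" if "master_feasible D cuts m" for m
      using master_value_le[OF that] that by (auto simp: master_feasible_def Let_def)
    show "\<exists>m. master_feasible D cuts m \<and> mz m = v" if "v \<in> ?V" for v
      using that master_value_attained by blast
  qed
  then show ?thesis by (auto simp: master_optimal_def)
qed

lemma c_min_props:
  assumes "n \<in> orders D"
  shows "s \<in> sat_services D \<Longrightarrow> c_min D n \<le> c_ho D (dest D s) n"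
    and "m \<in> orders D \<Longrightarrow> m \<noteq> n \<Longrightarrow> c_min D n \<le> c_oo D m n"
    and "s \<in> sat_services D \<Longrightarrow> 0 \<le> c_min D n"
proof -
  let ?A = "(\<lambda>m. c_oo D m n) ` (orders D - {n}) \<union> (\<lambda>l. c_ho D l n) ` sat_hubs D"
  show "c_min D n \<le> c_ho D (dest D s) n" if "s \<in> sat_services D"
    unfolding c_min_def by (rule Min_le) (use that sat_hub in auto)
  show "c_min D n \<le> c_oo D m n" if "m \<in> orders D" "m \<noteq> n"
    unfolding c_min_def by (rule Min_le) (use that in auto)
  show "0 \<le> c_min D n" if "s \<in> sat_services D"
    unfolding c_min_def
  proof (rule Min.boundedI)
    show "?A \<noteq> {}" using sat_hub[OF that] by auto
    have "0 \<le> c_oo D m n" if "m \<in> orders D - {n}" for m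
      using c_oo_pos[of m n] that assms by auto
    moreover have "0 \<le> c_ho D l n" if "l \<in> sat_hubs D" for l
      using costs assms that by (simp add: cost_conditions_def)
    ultimately show "0 \<le> a" if "a \<in> ?A" for a using that by blast
  qed auto
qed

text \<open>A service that carries no order can be closed by cancelling the empty compartments on it,
  which saves at least its fixed cost.\<close>

lemma master_optimal_assigned:
  assumes m: "master_optimal D cuts m" and s: "s \<in> active D (mplan m)"
  shows "assigned D (mplan m) s \<noteq> {}"
proof
  assume empty: "assigned D (mplan m) s = {}"
  define X where "X = mplan m"
  have sat: "s \<in> sat_services D" and vs: "vv X s = 1" using s by (auto simp: active_def X_def)
  have fm: "master_feasible D cuts m"
    and opt: "\<And>m'. master_feasible D cuts m' \<Longrightarrow> \<not> mz m' < mz m"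
    using m by (auto simp: master_optimal_def is_arg_min_def)
  note fm' = fm[unfolded master_feasible_def Let_def, folded X_def]
  have X: "intermodal_feasible D X" using fm' by blast
  \<comment> \<open>No order has \<open>hv\<close> equal to 1 on \<open>s\<close>, so the linking
    constraint forces every compartment travelling on \<open>s\<close> to be empty.\<close>
  have y0: "yv X n g = 0" if "n \<in> orders D" "g \<in> comps D" "xv X g s = 1" for n g
  proof -
    have "hv X n s = 0"
      using empty feasible_binary(4)[OF X that(1) sat] that(1) by (auto simp: assigned_def X_def)
    then show ?thesis
      using feasible_hv[OF X that(1,2) sat] feasible_binary(2)[OF X that(1,2)] that(3) by auto
  qed
  \<comment> \<open>The whole itinerary of such a compartment is cancelled, not just its last leg,
    so that flow conservation survives.\<close>
  define x' where "x' g t = (if xv X g s = 1 then 0 else xv X g t)" for g t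
  define Y where "Y = X\<lparr>xv := x', ev := (\<lambda>g. if xv X g s = 1 then 0 else ev X g),
    vv := (vv X)(s := 0), Vv := (\<lambda>t. \<Sum>g\<in>comps D. x' g t)\<rparr>"
  have Y_sel: "xv Y = x'" "ev Y = (\<lambda>g. if xv X g s = 1 then 0 else ev X g)" "vv Y = (vv X)(s := 0)"
    "Vv Y = (\<lambda>t. \<Sum>g\<in>comps D. x' g t)" "yv Y = yv X" "hv Y = hv X" "Ev Y = Ev X"
    by (simp_all add: Y_def)
  have x'_bin: "x' g t \<in> {0, 1}" and x'_le: "x' g t \<le> xv X g t"
    if "g \<in> comps D" "t \<in> services D" for g t
    using feasible_binary(1)[OF X that] by (auto simp: x'_def)
  have x'_s: "x' g s = 0" if "g \<in> comps D" for g
    using feasible_binary(1)[OF X that sat_service[OF sat]] by (auto simp: x'_def)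
  have V_le: "Vv Y t \<le> Vv X t" if "t \<in> services D" for t
    unfolding Y_sel feasible_Vv[OF X that] by (rule sum_mono) (use x'_le that in auto)
  have V_ge: "0 \<le> Vv Y t" "Vv Y t \<in> \<int>" if "t \<in> services D" for t
  proof -
    show "0 \<le> Vv Y t" unfolding Y_sel by (rule sum_nonneg) (use x'_bin that in fastforce)
    show "Vv Y t \<in> \<int>" unfolding Y_sel by (rule Ints_sum) (use x'_bin that in fastforce)
  qed
  have x'_sum: "(\<Sum>t\<in>A. x' g t) = (if xv X g s = 1 then 0 else (\<Sum>t\<in>A. xv X g t))" for A g
    by (simp add: x'_def)
  have dom: "plan_domains D X" using X unfolding intermodal_feasible_def by blast
  have domY: "plan_domains D Y"
  proof -
    have "Vv Y t \<le> serv_cap D t" if "t \<in> services D" for t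
    proof -
      have "Vv X t \<le> serv_cap D t" using dom that unfolding plan_domains_def by blast
      then show ?thesis using V_le[OF that] by linarith
    qed
    moreover have "ev Y g \<in> {0, 1}" if "g \<in> comps D" for g
      using feasible_binary(5)[OF X that] by (simp add: Y_sel)
    moreover have "vv Y t \<in> {0, 1}" if "t \<in> services D" for t
      using feasible_binary(3)[OF X that] by (simp add: Y_sel)
    moreover have "xv Y g t \<in> {0, 1}" if "g \<in> comps D" "t \<in> services D" for g t
      using x'_bin[OF that] by (simp add: Y_sel)
    ultimately show ?thesis
      using dom V_ge unfolding plan_domains_def Y_sel(5-7) by simp
  qed
  have Y: "intermodal_feasible D Y"
  proof -
    have "yv Y n g \<le> ev Y g" if "g \<in> comps D" "n \<in> orders D" for g n
      using feasible_ev[OF X that] y0[OF that(2,1)] by (simp add: Y_sel)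
    moreover have "xv Y g t + xv Y g u \<le> 1"
      if "g \<in> comps D" "t \<in> services D" "u \<in> conflicts D t" for g t u
    proof -
      have "xv X g t + xv X g u \<le> 1" using X that unfolding intermodal_feasible_def by blast
      then show ?thesis by (simp add: Y_sel x'_def)
    qed
    moreover have "xv Y g t \<le> vv Y t" if "g \<in> comps D" "t \<in> services D" for g t
      using feasible_vv[OF X that] x'_s[OF that(1)] x'_le[OF that] by (auto simp: Y_sel)
    moreover have "xv Y g t + yv Y n g \<le> hv Y n t + 1"
      if "n \<in> orders D" "g \<in> comps D" "t \<in> sat_services D" for n g t
      using feasible_hv[OF X that] x'_le[OF that(2) sat_service[OF that(3)]] by (auto simp: Y_sel)
    moreover have "(\<Sum>t\<in>out_services D j. xv Y g t) = ev Y g"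
      if "j \<in> dc_hubs D" "g \<in> comps D" "comp_hub D g = j" for j g
    proof -
      have "(\<Sum>t\<in>out_services D j. xv X g t) = ev X g"
        using X that unfolding intermodal_feasible_def by blast
      then show ?thesis by (simp add: Y_sel x'_sum)
    qed
    moreover have "(\<Sum>t\<in>out_services D i. xv Y g t) - (\<Sum>t\<in>in_services D i. xv Y g t) = 0"
      if "j \<in> dc_hubs D" "g \<in> comps D" "comp_hub D g = j" "i \<in> hubs D - (sat_hubs D \<union> {j})" for j g i
    proof -
      have "(\<Sum>t\<in>out_services D i. xv X g t) - (\<Sum>t\<in>in_services D i. xv X g t) = 0"
        using X that unfolding intermodal_feasible_def by blast
      then show ?thesis by (simp add: Y_sel x'_sum)
    qed
    moreover have "(\<Sum>l\<in>sat_hubs D. \<Sum>t\<in>in_services D l. xv Y g t) = ev Y g" if "g \<in> comps D" for g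
      using feasible_sat_sum[OF X that] by (simp add: sum_sat_services Y_sel x'_sum)
    moreover have "Vv Y t = (\<Sum>g\<in>comps D. xv Y g t)" for t by (simp add: Y_sel)
    moreover have "\<forall>n\<in>orders D. (\<Sum>g\<in>comps D. yv Y n g) = 1"
      "\<forall>g\<in>comps D. Ev Y g = (\<Sum>n\<in>orders D. quantity D n * yv Y n g)"
      using X unfolding intermodal_feasible_def Y_sel by blast+
    ultimately show ?thesis using domY unfolding intermodal_feasible_def by blast
  qed
  have "transport_cost D Y < transport_cost D X"
    unfolding transport_cost_def
  proof (rule sum_strict_mono_ex1)
    have cost_nonneg: "0 \<le> c_travel D t" "0 \<le> c_fixed D t" if "t \<in> services D" for t
      using costs that by (auto simp: cost_conditions_def)
    have "vv Y t \<le> vv X t" if "t \<in> services D" for t using vs by (simp add: Y_sel)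
    then show "\<forall>t\<in>services D. c_travel D t * Vv Y t + c_fixed D t * vv Y t
        \<le> c_travel D t * Vv X t + c_fixed D t * vv X t"
      using V_le cost_nonneg by (intro ballI add_mono mult_left_mono) auto
    have "c_travel D s * Vv Y s \<le> c_travel D s * Vv X s"
      using V_le cost_nonneg sat_service[OF sat] by (intro mult_left_mono) auto
    moreover have "0 < c_fixed D s" using costs sat by (simp add: cost_conditions_def)
    ultimately have "c_travel D s * Vv Y s + c_fixed D s * vv Y s < c_travel D s * Vv X s + c_fixed D s * vv X s"
      using vs by (simp add: Y_sel)
    then show "\<exists>t\<in>services D. c_travel D t * Vv Y t + c_fixed D t * vv Y t
        < c_travel D t * Vv X t + c_fixed D t * vv X t"
      using sat_service[OF sat] by blast
  qed simp
  \<comment> \<open>Every lower bound on the master objective contains the transport cost, and its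
    other terms see only \<open>hv\<close> and auxiliary variables. The saving \<open>d\<close> can
    therefore be passed on in full.\<close>
  then obtain d where d: "d > 0" "transport_cost D Y = transport_cost D X - d"
    using that[of "transport_cost D X - transport_cost D Y"] by simp
  have "cut_term c Y = cut_term c X" for c by (simp add: cut_term_def Y_sel fun_eq_iff)
  then have "master_feasible D cuts (m\<lparr>mplan := Y, mz := mz m - d\<rparr>)"
    using fm' Y unfolding master_feasible_def Let_def cut_satisfied_iff
    by (simp add: d(2) Y_sel)
  then show False using opt[of "m\<lparr>mplan := Y, mz := mz m - d\<rparr>"] d(1) by simp
qed

section \<open>Optimal values of the subproblems\<close>

lemma sub_values_route:
  assumes "sub_values D M X \<zeta>" "s \<in> active D X"
  obtains ns where "distinct ns" "set ns = assigned D X s" "ns \<noteq> []" "\<zeta> s = route_cost s ns"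
    "\<And>ns'. distinct ns' \<Longrightarrow> set ns' = assigned D X s \<Longrightarrow> \<zeta> s \<le> route_cost s ns'"
    "0 \<le> \<zeta> s"
proof -
  have sat: "s \<in> sat_services D" using assms by (simp add: active_def)
  have H: "assigned D X s \<subseteq> orders D" by (auto simp: assigned_def)
  obtain R where R: "is_arg_min szeta (sub_feasible D M s (assigned D X s)) R" "\<zeta> s = szeta R"
    using assms unfolding sub_values_def by blast
  then have f: "sub_feasible D M s (assigned D X s) R"
    and opt: "\<And>R'. sub_feasible D M s (assigned D X s) R' \<Longrightarrow> szeta R \<le> szeta R'"
    by (auto simp: is_arg_min_def not_less)
  have ne: "assigned D X s \<noteq> {}" by (rule sub_feasible_nonempty[OF f])
  obtain R' ns where R': "is_arg_min szeta (sub_feasible D M s (assigned D X s)) R'"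
    "szeta R' = route_cost s ns" "distinct ns" "set ns = assigned D X s"
    by (rule sub_optimum_exists[OF sat H ne])
  have "szeta R = szeta R'" using R'(1) f opt[of R'] by (auto simp: is_arg_min_def)
  then have eq: "\<zeta> s = route_cost s ns" using R R' by simp
  have le: "\<zeta> s \<le> route_cost s ns'" if "distinct ns'" "set ns' = assigned D X s" for ns'
    using sub_feasible_of_route[OF sat that(1)] that H ne opt R(2) by fastforce
  have "0 \<le> route_cost s ns"
    unfolding route_cost_def
    using route_length_nonneg[OF sat R'(3)] R'(4) H weight_nonneg
    by (intro add_nonneg_nonneg sum_nonneg mult_nonneg_nonneg) auto
  moreover have "ns \<noteq> []" using R'(4) ne by auto
  ultimately show ?thesis using that[of ns] R' eq le by simp
qed

lemma sub_values_exists: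
  assumes "\<And>s. s \<in> active D X \<Longrightarrow> assigned D X s \<noteq> {}"
  shows "\<exists>\<zeta>. sub_values D M X \<zeta>"
proof -
  have "\<exists>v R. is_arg_min szeta (sub_feasible D M s (assigned D X s)) R \<and> v = szeta R"
    if "s \<in> active D X" for s
    using sub_optimum_exists[of s "assigned D X s"] that assms[OF that]
    by (auto simp: active_def assigned_def)
  then show ?thesis unfolding sub_values_def by (intro bchoice) blast
qed

lemma sub_values_unique:
  assumes "sub_values D M X \<zeta>" "sub_values D M Y \<zeta>'" "s \<in> active D X" "s \<in> active D Y"
    and "assigned D X s = assigned D Y s"
  shows "\<zeta> s = \<zeta>' s"
proof -
  obtain ns where ns: "distinct ns" "set ns = assigned D X s" "\<zeta> s = route_cost s ns"
    "\<And>ns'. distinct ns' \<Longrightarrow> set ns' = assigned D X s \<Longrightarrow> \<zeta> s \<le> route_cost s ns'"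
    by (rule sub_values_route[OF assms(1,3)]) (rule that)
  obtain ns' where ns': "distinct ns'" "set ns' = assigned D Y s" "\<zeta>' s = route_cost s ns'"
    "\<And>ns. distinct ns \<Longrightarrow> set ns = assigned D Y s \<Longrightarrow> \<zeta>' s \<le> route_cost s ns"
    by (rule sub_values_route[OF assms(2,4)]) (rule that)
  show ?thesis using ns(4)[of ns'] ns'(4)[of ns] ns ns' assms(5) by simp
qed

section \<open>Validity of the cuts\<close>

text \<open>The plan of a solution of the full problem may put an order on several services, and then
  an optimality cut, which counts its tardiness once per service, need not be valid. Reducing
  \<open>hv\<close> to the single service that carries each order restores validity.\<close>

lemma master_lower_bound:
  assumes P: "P_feasible D M p"
    and cuts: "\<And>c. c \<in> set cuts \<Longrightarrow> sub_values D M (fst c) (snd c)"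
  shows "\<exists>Y. intermodal_feasible D Y \<and> master_value cuts Y \<le> P_objective D p"
proof -
  obtain X R where p: "p = (X, R)" by (cases p)
  have X: "intermodal_feasible D X" and R: "routing_feasible D M X R"
    using P by (auto simp: P_feasible_def p)
  define H where "H s = {n \<in> orders D. carries X n s}" for s
  define Y where "Y = X\<lparr>hv := (\<lambda>n s. of_bool (carries X n s))\<rparr>"
  have Y: "intermodal_feasible D Y"
    unfolding Y_def by (rule intermodal_feasible_hv_update[OF X]) auto
  have f: "transport_cost D Y = transport_cost D X" by (simp add: Y_def)
  have hY: "hv Y n s = of_bool (carries X n s)" for n s by (simp add: Y_def)
  have H: "H s \<subseteq> orders D" "H s \<subseteq> assigned D X s" if "s \<in> sat_services D" for s
    using carries_active(1)[OF X _ that] by (auto simp: H_def assigned_def)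
  have fin: "finite (H s)" for s by (simp add: H_def)
  have tard: "tard R n \<in> \<nat>" if "n \<in> orders D" for n
    using R that unfolding routing_feasible_def by blast
  have tard_nonneg: "0 \<le> tard R n" if "n \<in> orders D" for n
    using tard[OF that] by (auto elim: Nats_cases)
  note rf = R[unfolded routing_feasible_def ball_sat_services, THEN conjunct2]
  have tard_ge: "(compl R s n - due D n) / 24 \<le> tard R n" if "s \<in> sat_services D" "n \<in> orders D" for s n
    using rf that by blast
  have cmax: "0 \<le> cmax R s" if "s \<in> sat_services D" for s
    using rf that by blast
  \<comment> \<open>The routing on \<open>s\<close> is restricted to its assigned orders, and those
    outside \<open>H'\<close> are skipped. This serves three times: for one order, for all of
    \<open>H s\<close>, and for the orders of a cut.\<close>
  have route: "\<exists>ns. distinct ns \<and> set ns = H' \<and> route_length s ns \<le> cmax R s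
      \<and> (\<forall>n\<in>H'. route_times s ns n \<le> compl R s n)"
    if s: "s \<in> sat_services D" and H': "H' \<subseteq> H s" "H' \<noteq> {}" for s H'
  proof -
    obtain n where "n \<in> orders D" "carries X n s" using H' by (auto simp: H_def)
    then have "vv X s = 1" using carries_active(2)[OF X _ s] by blast
    then obtain R' where R': "sub_feasible D M s (assigned D X s) R'" "scmax R' = cmax R s"
      "scompl R' = compl R s"
      using sub_feasible_of_routing[OF X R s] by blast
    have sub: "assigned D X s \<subseteq> orders D" "H' \<subseteq> assigned D X s"
      using H(2)[OF s] H' by (auto simp: assigned_def)
    obtain ns where "distinct ns" "set ns = H'" "route_length s ns \<le> scmax R'"
      "\<And>n. n \<in> H' \<Longrightarrow> route_times s ns n \<le> scompl R' n"
      by (rule route_of_sub_feasible[OF s sub R'(1)]) (rule that)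
    then show ?thesis using R' by auto
  qed
  have late: "(arrival D s + c_ho D (dest D s) n - due D n) / 24 * hv Y n s \<le> tard R n"
    if s: "s \<in> sat_services D" and n: "n \<in> orders D" for s n
  proof (cases "carries X n s")
    case True
    then obtain ns where ns: "distinct ns" "set ns = {n}" "route_times s ns n \<le> compl R s n"
      using route[OF s, of "{n}"] n by (auto simp: H_def)
    \<comment> \<open>The route through \<open>n\<close> alone is direct delivery from the hub, the
      quantity in the tardiness relaxation.\<close>
    then have "ns = [n]" by (cases ns) (auto simp: subset_singleton_iff)
    then have "arrival D s + c_ho D (dest D s) n \<le> compl R s n"
      using ns(3) by (simp add: route_times_def route_start_def)
    then show ?thesis using tard_ge[OF s n] True by (simp add: hY)
  next
    case False
    then show ?thesis using tard_nonneg[OF n] by (simp add: hY)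
  qed
  have length: "(\<Sum>n\<in>orders D. c_min D n * hv Y n s) \<le> cmax R s" if s: "s \<in> sat_services D" for s
  proof -
    have eq: "(\<Sum>n\<in>orders D. c_min D n * hv Y n s) = sum (c_min D) (H s)"
    proof -
      have "sum (c_min D) (H s) = (\<Sum>n\<in>orders D. if carries X n s then c_min D n else 0)"
        unfolding H_def by (rule sum.inter_filter) simp
      also have "\<dots> = (\<Sum>n\<in>orders D. c_min D n * hv Y n s)"
        by (intro sum.cong) (auto simp: hY)
      finally show ?thesis by simp
    qed
    show ?thesis
    proof (cases "H s = {}")
      case True
      then show ?thesis using eq cmax[OF s] by simp
    next
      case False
      then obtain ns where ns: "distinct ns" "set ns = H s" "route_length s ns \<le> cmax R s"
        using route[OF s order_refl] by blast
      have "sum (c_min D) (set ns) \<le> route_length s ns"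
        unfolding route_length_def
      proof (rule path_length_ge_sum[OF ns(1)])
        show "c_min D n \<le> c_ho D (dest D s) n" if "n \<in> set ns" for n
          using c_min_props(1)[OF _ s] that ns H(1)[OF s] by blast
        show "c_min D m \<le> c_oo D n m" if "n \<in> set ns" "m \<in> set ns" "n \<noteq> m" for n m
          using c_min_props(2)[of m n] that ns H(1)[OF s] by blast
      qed
      then show ?thesis using eq ns by simp
    qed
  qed
  have obj: "P_objective D p = transport_cost D Y + (\<Sum>s\<in>sat_services D. cmax R s)
    + (\<Sum>n\<in>orders D. weight D n * tard R n)"
    by (simp add: P_objective_def p f)
  have "0 \<le> (\<Sum>s\<in>sat_services D. cmax R s)" "0 \<le> (\<Sum>n\<in>orders D. weight D n * tard R n)"
    using cmax weight_nonneg tard_nonneg by (auto intro!: sum_nonneg)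
  then have "transport_cost D Y \<le> P_objective D p" by (simp add: obj)
  moreover have "relaxed_cost Y \<le> P_objective D p"
  proof -
    have "real (master_tard Y n) \<le> tard R n" if n: "n \<in> orders D" for n
    proof -
      obtain k where k: "tard R n = real k" using tard[OF n] by (rule Nats_cases)
      have "master_tard Y n \<le> k"
        unfolding master_tard_def using late[OF _ n] k
        by (subst Max_le_iff) (auto simp: nat_le_iff ceiling_le_iff)
      then show ?thesis using k by simp
    qed
    then have "(\<Sum>n\<in>orders D. weight D n * real (master_tard Y n)) \<le> (\<Sum>n\<in>orders D. weight D n * tard R n)"
      by (intro sum_mono mult_left_mono weight_nonneg)
    moreover have "(\<Sum>s\<in>sat_services D. \<Sum>n\<in>orders D. c_min D n * hv Y n s) \<le> (\<Sum>s\<in>sat_services D. cmax R s)"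
      by (intro sum_mono length)
    ultimately show ?thesis by (simp add: relaxed_cost_def obj)
  qed
  moreover have "cut_cost Y c \<le> P_objective D p" if c: "c \<in> set cuts" for c
  proof -
    let ?w = "\<lambda>n. weight D n * tard R n"
    have w: "0 \<le> ?w n" if "n \<in> orders D" for n
      using weight_nonneg[OF that] tard_nonneg[OF that] by simp
    have term_le: "cut_term c Y s \<le> cmax R s + sum ?w (H s)" if s: "s \<in> active D (fst c)" for s
    proof -
      have sat: "s \<in> sat_services D" using s by (simp add: active_def)
      define H' where "H' = assigned D (fst c) s"
      have H': "H' \<subseteq> orders D" by (auto simp: H'_def assigned_def)
      have fin': "finite H'" by (rule finite_subset[OF H' finite_sets(1)])
      obtain xs where xs: "set xs = H'" "xs \<noteq> []" "0 \<le> snd c s"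
        and le: "\<And>ns. distinct ns \<Longrightarrow> set ns = H' \<Longrightarrow> snd c s \<le> route_cost s ns"
        by (rule sub_values_route[OF cuts[OF c] s, folded H'_def]) (rule that)
      have nonneg: "0 \<le> cmax R s + sum ?w (H s)"
        using cmax[OF sat] w H(1)[OF sat] by (intro add_nonneg_nonneg sum_nonneg) auto
      have hsum: "(\<Sum>n\<in>H'. hv Y n s) = real (card {n \<in> H'. carries X n s})"
        using fin' by (simp add: hY of_bool_def sum.inter_filter[symmetric])
      show ?thesis
      proof (cases "H' \<subseteq> H s")
        \<comment> \<open>All orders of the cut travel on \<open>s\<close>, so the cut demands the
          full subproblem value. That value is at most the cost of the actual tour with the other
          orders skipped.\<close>
        case True
        obtain ns where ns: "distinct ns" "set ns = H'" "route_length s ns \<le> cmax R s"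
          "\<And>n. n \<in> H' \<Longrightarrow> route_times s ns n \<le> compl R s n"
          using route[OF sat True] xs by auto
        have "{n \<in> H'. carries X n s} = H'" using True by (auto simp: H_def)
        then have "cut_term c Y s = snd c s"
          using hsum xs(3) by (simp add: cut_term_def H'_def[symmetric])
        also have "\<dots> \<le> route_cost s ns" by (rule le[OF ns(1,2)])
        also have "\<dots> \<le> cmax R s + sum ?w H'"
          by (rule route_cost_le[OF fin' H' ns(2-4)]) (use tard tard_ge[OF sat] H' in auto)
        also have "\<dots> \<le> cmax R s + sum ?w (H s)"
          using True w H(1)[OF sat] fin by (intro add_left_mono sum_mono2) auto
        finally show ?thesis .
      next
        \<comment> \<open>One missing order already deducts the full, nonnegative subproblem value,
          so the cut demands nothing.\<close>
        case False
        then have "{n \<in> H'. carries X n s} \<subset> H'" using H' by (auto simp: H_def)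
        then have "card {n \<in> H'. carries X n s} < card H'" using fin' by (rule psubset_card_mono[rotated])
        then have "snd c s * 1 \<le> snd c s * (real (card H') - real (card {n \<in> H'. carries X n s}))"
          using xs(3) by (intro mult_left_mono) auto
        then have "cut_term c Y s = 0" unfolding cut_term_def H'_def[symmetric] hsum by simp
        then show ?thesis using nonneg by simp
      qed
    qed
    have "(\<Sum>s\<in>active D (fst c). cut_term c Y s) \<le> (\<Sum>s\<in>active D (fst c). cmax R s + sum ?w (H s))"
      by (rule sum_mono) (rule term_le)
    also have "\<dots> \<le> (\<Sum>s\<in>sat_services D. cmax R s + sum ?w (H s))"
      using cmax w H(1) by (intro sum_mono2 add_nonneg_nonneg sum_nonneg) (auto simp: active_def)
    also have "\<dots> = (\<Sum>s\<in>sat_services D. cmax R s) + (\<Sum>s\<in>sat_services D. sum ?w (H s))"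
      by (rule sum.distrib)
    also have "(\<Sum>s\<in>sat_services D. sum ?w (H s))
        = (\<Sum>n\<in>orders D. \<Sum>s\<in>{s \<in> sat_services D. carries X n s}. ?w n)"
      unfolding H_def by (rule sum.swap_restrict) auto
    \<comment> \<open>Here the reduction to carriers pays off: each order sits on exactly one
      service, so its tardiness is counted once.\<close>
    also have "\<dots> = (\<Sum>n\<in>orders D. ?w n)"
    proof (rule sum.cong[OF refl])
      fix n assume n: "n \<in> orders D"
      obtain s where s: "s \<in> sat_services D" "carries X n s" by (rule carries_exists[OF X n])
      then have "{s \<in> sat_services D. carries X n s} = {s}" using carries_unique[OF X n] by blast
      then show "(\<Sum>s\<in>{s \<in> sat_services D. carries X n s}. ?w n) = ?w n" by simp
    qed
    finally show ?thesis by (simp add: cut_cost_def obj)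
  qed
  ultimately have "master_value cuts Y \<le> P_objective D p" by (auto simp: master_value_def)
  then show ?thesis using Y by blast
qed

lemma master_optimal_bound:
  assumes m: "master_optimal D cuts m" and P: "P_feasible D M p"
    and cuts: "\<And>c. c \<in> set cuts \<Longrightarrow> sub_values D M (fst c) (snd c)"
  shows "mz m \<le> P_objective D p"
proof -
  obtain Y where Y: "intermodal_feasible D Y" "master_value cuts Y \<le> P_objective D p"
    using master_lower_bound[OF P cuts] by blast
  obtain m' where "master_feasible D cuts m'" "mz m' = master_value cuts Y"
    using master_value_attained[OF Y(1)] by blast
  then show ?thesis using m Y(2) by (auto simp: master_optimal_def is_arg_min_def)
qed

lemma P_solution_of_sub_values:
  assumes X: "intermodal_feasible D X" and \<zeta>: "sub_values D M X \<zeta>"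
  obtains R where "P_feasible D M (drop_unused X, R)"
    "P_objective D (drop_unused X, R) = transport_cost D X + (\<Sum>s\<in>active D X. \<zeta> s)"
proof -
  have "\<forall>s\<in>active D X. \<exists>ns. distinct ns \<and> set ns = assigned D X s \<and> ns \<noteq> [] \<and> \<zeta> s = route_cost s ns"
  proof
    fix s assume "s \<in> active D X"
    then show "\<exists>ns. distinct ns \<and> set ns = assigned D X s \<and> ns \<noteq> [] \<and> \<zeta> s = route_cost s ns"
      by (rule sub_values_route[OF \<zeta>]) blast
  qed
  then obtain L0 where L0: "\<And>s. s \<in> active D X \<Longrightarrow> distinct (L0 s) \<and> set (L0 s) = assigned D X s
      \<and> L0 s \<noteq> [] \<and> \<zeta> s = route_cost s (L0 s)"
    by (metis bchoice)
  \<comment> \<open>A closed service gets the empty route. This agrees with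
    \<open>drop_unused\<close>, which sets \<open>hv\<close> to 0 there.\<close>
  define L where "L s = (if s \<in> active D X then L0 s else [])" for s
  define Y where "Y = drop_unused X"
  have Y: "intermodal_feasible D Y" unfolding Y_def by (rule drop_unused_feasible[OF X])
  have "routing_feasible D M Y (routing_of_routes L)"
  proof (rule routing_of_routes_feasible[OF Y])
    fix s assume s: "s \<in> sat_services D"
    show "distinct (L s)" using L0 by (simp add: L_def)
    show "L s \<noteq> [] \<longleftrightarrow> vv Y s = 1"
      using L0 s by (auto simp: L_def Y_def drop_unused_def active_def)
    have "vv X s \<in> {0, 1}" using feasible_binary(3)[OF X sat_service[OF s]] .
    then show "set (L s) = {n \<in> orders D. hv Y n s = 1}"
      using L0 s by (auto simp: L_def Y_def drop_unused_def active_def assigned_def)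
  qed
  moreover have "P_objective D (Y, routing_of_routes L) = transport_cost D Y + (\<Sum>s\<in>sat_services D. route_cost s (L s))"
    by (rule P_objective_routing_of_routes) (use L0 in \<open>auto simp: L_def assigned_def\<close>)
  moreover have "(\<Sum>s\<in>sat_services D. route_cost s (L s)) = (\<Sum>s\<in>active D X. \<zeta> s)"
  proof -
    have "(\<Sum>s\<in>sat_services D. route_cost s (L s)) = (\<Sum>s\<in>active D X. route_cost s (L s))"
      by (rule sum.mono_neutral_right) (auto simp: L_def active_def route_cost_def route_length_def)
    also have "\<dots> = (\<Sum>s\<in>active D X. \<zeta> s)" using L0 by (intro sum.cong) (auto simp: L_def)
    finally show ?thesis .
  qed
  ultimately show ?thesis
    using that[of "routing_of_routes L"] Y by (simp add: P_feasible_def Y_def drop_unused_def)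
qed

section \<open>Runs of the algorithm\<close>

text \<open>The disjunction separates the initial state, whose \<open>st_eps\<close> is arbitrary
  but passes the loop test, from later ones, whose \<open>st_eps\<close> is a sum of subproblem
  values. A state that fails the test is therefore of the second kind.\<close>

definition lbbd_inv :: "('n, 'g, 's) lbbd_state \<Rightarrow> bool" where
  "lbbd_inv \<sigma> \<longleftrightarrow> (\<forall>c\<in>set (st_cuts \<sigma>). sub_values D M (fst c) (snd c))
     \<and> (\<exists>m. master_optimal D (st_cuts \<sigma>) m \<and> st_plan \<sigma> = mplan m \<and> st_z \<sigma> = mz m)
     \<and> (lbbd_continue D \<sigma>
        \<or> (\<exists>\<zeta>. sub_values D M (st_plan \<sigma>) \<zeta> \<and> st_eps \<sigma> = (\<Sum>s\<in>active D (st_plan \<sigma>). \<zeta> s)))"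

lemma lbbd_init_inv: "lbbd_init D \<epsilon>0 \<sigma> \<Longrightarrow> lbbd_inv \<sigma>"
  by (auto simp: lbbd_init_def lbbd_inv_def)

lemma lbbd_step_inv: "lbbd_inv \<sigma> \<Longrightarrow> lbbd_step D M \<sigma> \<tau> \<Longrightarrow> lbbd_inv \<tau>"
  by (auto simp: lbbd_step_def lbbd_inv_def)

text \<open>The subproblems are solvable because the plan comes from an optimal master solution; a
  merely feasible one could open a service without orders.\<close>

lemma lbbd_inv_plan:
  assumes "lbbd_inv \<sigma>"
  shows "intermodal_feasible D (st_plan \<sigma>)" "\<exists>\<zeta>. sub_values D M (st_plan \<sigma>) \<zeta>"
proof -
  obtain m where m: "master_optimal D (st_cuts \<sigma>) m" "st_plan \<sigma> = mplan m"
    using assms by (auto simp: lbbd_inv_def)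
  then show "intermodal_feasible D (st_plan \<sigma>)"
    by (auto simp: master_optimal_def is_arg_min_def master_feasible_def Let_def)
  show "\<exists>\<zeta>. sub_values D M (st_plan \<sigma>) \<zeta>"
    unfolding m(2) by (rule sub_values_exists) (rule master_optimal_assigned[OF m(1)])
qed

lemma lbbd_progress:
  assumes inv: "lbbd_inv \<sigma>" and cont: "lbbd_continue D \<sigma>"
  shows "\<exists>\<tau>. lbbd_step D M \<sigma> \<tau>"
proof -
  obtain \<zeta> where \<zeta>: "sub_values D M (st_plan \<sigma>) \<zeta>" using lbbd_inv_plan(2)[OF inv] by blast
  let ?cuts = "st_cuts \<sigma> @ [(st_plan \<sigma>, \<zeta>)]"
  obtain m where m: "master_optimal D ?cuts m"
    using master_optimal_exists[OF lbbd_inv_plan(1)[OF inv]] by blast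
  obtain \<zeta>' where "sub_values D M (mplan m) \<zeta>'"
    using sub_values_exists[of "mplan m"] master_optimal_assigned[OF m] by blast
  then show ?thesis using cont \<zeta> m unfolding lbbd_step_def by blast
qed

lemma lbbd_correct:
  assumes inv: "lbbd_inv \<tau>" and stop: "\<not> lbbd_continue D \<tau>"
  shows "\<exists>R. is_arg_min (P_objective D) (P_feasible D M) (drop_unused (st_plan \<tau>), R)
    \<and> st_z \<tau> = P_objective D (drop_unused (st_plan \<tau>), R)"
proof -
  obtain \<zeta> where \<zeta>: "sub_values D M (st_plan \<tau>) \<zeta>" "st_eps \<tau> = (\<Sum>s\<in>active D (st_plan \<tau>). \<zeta> s)"
    using inv stop by (auto simp: lbbd_inv_def)
  obtain m where m: "master_optimal D (st_cuts \<tau>) m" "st_z \<tau> = mz m"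
    using inv by (auto simp: lbbd_inv_def)
  have lower: "st_z \<tau> \<le> P_objective D p" if "P_feasible D M p" for p
    unfolding m(2) by (rule master_optimal_bound[OF m(1) that]) (use inv in \<open>simp add: lbbd_inv_def\<close>)
  obtain R where R: "P_feasible D M (drop_unused (st_plan \<tau>), R)"
    "P_objective D (drop_unused (st_plan \<tau>), R) = transport_cost D (st_plan \<tau>) + st_eps \<tau>"
    by (rule P_solution_of_sub_values[OF lbbd_inv_plan(1)[OF inv] \<zeta>(1), folded \<zeta>(2)]) (rule that)
  have "P_objective D (drop_unused (st_plan \<tau>), R) \<le> st_z \<tau>"
    using R(2) stop by (simp add: lbbd_continue_def)
  then have "st_z \<tau> = P_objective D (drop_unused (st_plan \<tau>), R)" using lower[OF R(1)] by simp
  moreover from this have "is_arg_min (P_objective D) (P_feasible D M) (drop_unused (st_plan \<tau>), R)"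
    using lower R(1) by (fastforce simp: is_arg_min_def)
  ultimately show ?thesis by blast
qed

text \<open>The cut of an earlier plan with the same signature is tight at the current plan, so it
  lifts the master value up to the cost of that plan.\<close>

lemma lbbd_stops_on_repetition:
  assumes inv: "lbbd_inv \<tau>"
    and eps: "sub_values D M (st_plan \<tau>) \<zeta>'" "st_eps \<tau> = (\<Sum>s\<in>active D (st_plan \<tau>). \<zeta>' s)"
    and cut: "(X, \<zeta>) \<in> set (st_cuts \<tau>)" and sig: "plan_sig X = plan_sig (st_plan \<tau>)"
  shows "\<not> lbbd_continue D \<tau>"
proof -
  define Y where "Y = st_plan \<tau>"
  have \<zeta>: "sub_values D M X \<zeta>" using inv cut by (fastforce simp: lbbd_inv_def)
  obtain m where m: "master_optimal D (st_cuts \<tau>) m" "Y = mplan m" "st_z \<tau> = mz m"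
    using inv by (auto simp: lbbd_inv_def Y_def)
  have act: "active D X = active D Y" using plan_sig_active[OF sig] by (simp add: Y_def)
  have "cut_term (X, \<zeta>) Y s = \<zeta>' s" if s: "s \<in> active D Y" for s
  proof -
    have asg: "assigned D X s = assigned D Y s"
      using plan_sig_assigned[OF sig] s by (simp add: Y_def active_def)
    have "(\<Sum>n\<in>assigned D X s. hv Y n s) = real (card (assigned D X s))"
      unfolding asg by (simp add: assigned_def)
    moreover have "0 \<le> \<zeta> s" by (rule sub_values_route[OF \<zeta>]) (use s act in auto)
    moreover have "\<zeta> s = \<zeta>' s"
      by (rule sub_values_unique[OF \<zeta> eps(1)[folded Y_def]]) (use s act asg in auto)
    ultimately show ?thesis by (simp add: cut_term_def)
  qed
  then have "cut_cost Y (X, \<zeta>) = transport_cost D Y + st_eps \<tau>"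
    unfolding cut_cost_def eps(2) Y_def[symmetric] using act by simp
  moreover have "cut_cost Y (X, \<zeta>) \<le> master_value (st_cuts \<tau>) Y"
    unfolding master_value_def by (rule Max_ge) (use cut in auto)
  moreover have "master_value (st_cuts \<tau>) Y \<le> st_z \<tau>"
    using master_value_le[of "st_cuts \<tau>" m] m by (simp add: master_optimal_def is_arg_min_def)
  ultimately show ?thesis by (simp add: lbbd_continue_def Y_def)
qed

lemma lbbd_terminates:
  assumes inv: "lbbd_inv (run 0)" and step: "\<And>k. lbbd_step D M (run k) (run (Suc k))"
  shows False
proof -
  have invs: "lbbd_inv (run k)" for k
    by (induction k) (use inv lbbd_step_inv step in auto)
  have "set (st_cuts (run k)) \<subseteq> set (st_cuts (run (Suc k)))" for k
    using step[of k] by (auto simp: lbbd_step_def)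
  then have mono: "set (st_cuts (run i)) \<subseteq> set (st_cuts (run j))" if "i \<le> j" for i j
    using lift_Suc_mono_le[of "\<lambda>k. set (st_cuts (run k))"] that by blast
  have "finite (range (\<lambda>k. plan_sig (st_plan (run k))))"
    by (rule finite_subset[OF _ finite_plan_sigs]) auto
  then have "\<not> inj (\<lambda>k. plan_sig (st_plan (run k)))" using finite_imageD infinite_UNIV_nat by blast
  then obtain i j where ij: "i < j" "plan_sig (st_plan (run i)) = plan_sig (st_plan (run j))"
    unfolding inj_on_def by (metis linorder_neqE_nat)
  \<comment> \<open>The cut of plan \<open>i\<close> enters in the following round, which is no
    later than \<open>j\<close>, and cuts are never removed.\<close>
  obtain \<zeta> where \<zeta>: "(st_plan (run i), \<zeta>) \<in> set (st_cuts (run (Suc i)))"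
    using step[of i] unfolding lbbd_step_def by force
  then have cut: "(st_plan (run i), \<zeta>) \<in> set (st_cuts (run j))"
    using mono[of "Suc i" j] ij(1) by auto
  \<comment> \<open>Since \<open>j\<close> is positive, its state results from a step, so
    \<open>st_eps\<close> is a genuine sum of subproblem values and not the arbitrary initial
    number.\<close>
  obtain k where k: "j = Suc k" using ij(1) by (cases j) auto
  obtain \<zeta>' where "sub_values D M (st_plan (run j)) \<zeta>'"
    "st_eps (run j) = (\<Sum>s\<in>active D (st_plan (run j)). \<zeta>' s)"
    using step[of k] by (auto simp: lbbd_step_def k)
  then have "\<not> lbbd_continue D (run j)"
    by (rule lbbd_stops_on_repetition[OF invs _ _ cut ij(2)])
  then show False using step[of j] by (simp add: lbbd_step_def)
qed

lemma lbbd_init_exists: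
  assumes "P_feasible D M p"
  shows "\<exists>\<epsilon>0 \<sigma>. lbbd_init D \<epsilon>0 \<sigma>"
proof -
  obtain m where m: "master_optimal D [] m"
    using master_optimal_exists assms by (auto simp: P_feasible_def)
  \<comment> \<open>The witness exceeds the gap between master value and transport cost, so that the
    loop is entered; the maximum with 1 keeps it positive.\<close>
  define \<epsilon>0 where "\<epsilon>0 = max 1 (mz m - transport_cost D (mplan m) + 1)"
  have "lbbd_init D \<epsilon>0 \<lparr>st_cuts = [], st_plan = mplan m, st_z = mz m, st_eps = \<epsilon>0\<rparr>"
    using m by (auto simp: lbbd_init_def lbbd_continue_def \<epsilon>0_def)
  then show ?thesis by blast
qed

end

section \<open>The threshold for \<open>M\<close> and the convergence theorem\<close>

lemma delivery_network_exists:
  assumes "valid_network D" "cost_conditions D"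
  obtains K where "\<And>M. (real (card (orders D)) + 2) * K \<le> M \<Longrightarrow> delivery_network D K M"
proof -
  have fin: "finite (orders D)" "finite (sat_services D)"
    using assms(1) by (auto simp: valid_network_def sat_services_def)
  \<comment> \<open>Inserting 0 gives nonnegativity and keeps the maximum defined when there are no
    orders. \<open>K\<close> depends on the network only, so one threshold serves all larger
    \<open>M\<close>.\<close>
  define K where "K = Max (insert 0 ((\<lambda>(s, n). \<bar>arrival D s\<bar> + c_ho D (dest D s) n) ` (sat_services D \<times> orders D)
    \<union> (\<lambda>(n, m). c_oo D n m) ` (orders D \<times> orders D)))"
  have "delivery_network D K M" if "(real (card (orders D)) + 2) * K \<le> M" for M
  proof
    show "0 \<le> K" unfolding K_def by (rule Max_ge) (use fin in auto)
    show "\<bar>arrival D s\<bar> + c_ho D (dest D s) n \<le> K" if "s \<in> sat_services D" "n \<in> orders D" for s n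
      unfolding K_def by (rule Max_ge) (use fin that in auto)
    show "c_oo D n m \<le> K" if "n \<in> orders D" "m \<in> orders D" for n m
      unfolding K_def by (rule Max_ge) (use fin that in auto)
  qed (use assms that in auto)
  then show ?thesis by (rule that)
qed

theorem theorem2:
  fixes D :: "('i, 'n, 'g, 's) network"
  assumes "valid_network D" and "cost_conditions D"
  shows "\<exists>M0. \<forall>M\<ge>M0. (\<exists>p. P_feasible D M p) \<longrightarrow>
    (\<exists>\<epsilon>0 \<sigma>. lbbd_init D \<epsilon>0 \<sigma>) \<and>
    (\<forall>\<epsilon>0 \<sigma>. lbbd_init D \<epsilon>0 \<sigma> \<longrightarrow>
      \<not> (\<exists>run. run 0 = \<sigma> \<and> (\<forall>k. lbbd_step D M (run k) (run (Suc k)))) \<and>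
      (\<forall>\<tau>. (lbbd_step D M)\<^sup>*\<^sup>* \<sigma> \<tau> \<longrightarrow>
        (lbbd_continue D \<tau> \<longrightarrow> (\<exists>\<tau>'. lbbd_step D M \<tau> \<tau>')) \<and>
        (\<not> lbbd_continue D \<tau> \<longrightarrow>
          (\<exists>R. is_arg_min (P_objective D) (P_feasible D M) (drop_unused (st_plan \<tau>), R) \<and>
               st_z \<tau> = P_objective D (drop_unused (st_plan \<tau>), R)))))"
proof -
  obtain K where K: "\<And>M. (real (card (orders D)) + 2) * K \<le> M \<Longrightarrow> delivery_network D K M"
    by (rule delivery_network_exists[OF assms]) (rule that)
  show ?thesis
  proof (intro exI[of _ "(real (card (orders D)) + 2) * K"] allI impI)
    fix M assume "(real (card (orders D)) + 2) * K \<le> M" and "\<exists>p. P_feasible D M p"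
    then interpret delivery_network D K M by (intro K)
    show "(\<exists>\<epsilon>0 \<sigma>. lbbd_init D \<epsilon>0 \<sigma>) \<and>
    (\<forall>\<epsilon>0 \<sigma>. lbbd_init D \<epsilon>0 \<sigma> \<longrightarrow>
      \<not> (\<exists>run. run 0 = \<sigma> \<and> (\<forall>k. lbbd_step D M (run k) (run (Suc k)))) \<and>
      (\<forall>\<tau>. (lbbd_step D M)\<^sup>*\<^sup>* \<sigma> \<tau> \<longrightarrow>
        (lbbd_continue D \<tau> \<longrightarrow> (\<exists>\<tau>'. lbbd_step D M \<tau> \<tau>')) \<and>
        (\<not> lbbd_continue D \<tau> \<longrightarrow>
          (\<exists>R. is_arg_min (P_objective D) (P_feasible D M) (drop_unused (st_plan \<tau>), R) \<and>
               st_z \<tau> = P_objective D (drop_unused (st_plan \<tau>), R)))))"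
    proof (intro conjI allI impI)
      show "\<exists>\<epsilon>0 \<sigma>. lbbd_init D \<epsilon>0 \<sigma>" using \<open>\<exists>p. P_feasible D M p\<close> lbbd_init_exists by blast
    next
      fix \<epsilon>0 and \<sigma> :: "('n, 'g, 's) lbbd_state"
      assume "lbbd_init D \<epsilon>0 \<sigma>"
      then have inv: "lbbd_inv \<sigma>" by (rule lbbd_init_inv)
      show "\<not> (\<exists>run. run 0 = \<sigma> \<and> (\<forall>k. lbbd_step D M (run k) (run (Suc k))))"
        using lbbd_terminates inv by blast
      fix \<tau> assume "(lbbd_step D M)\<^sup>*\<^sup>* \<sigma> \<tau>"
      then have inv': "lbbd_inv \<tau>"
        by (induction rule: rtranclp_induct) (use inv lbbd_step_inv in auto)
      show "\<exists>\<tau>'. lbbd_step D M \<tau> \<tau>'" if "lbbd_continue D \<tau>"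
        by (rule lbbd_progress[OF inv' that])
      show "\<exists>R. is_arg_min (P_objective D) (P_feasible D M) (drop_unused (st_plan \<tau>), R) \<and>
          st_z \<tau> = P_objective D (drop_unused (st_plan \<tau>), R)" if "\<not> lbbd_continue D \<tau>"
        by (rule lbbd_correct[OF inv' that])
    qed
  qed
qed

end
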